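(* Let $X$ be a real Banach function space over $[0,1]$ such that $1\in X_a$. Let $\{L_n\}_{n\in\mathbb{N}}$ be a sequence of positive bounded linear operators on $X^S$ and let $A$ be a positive bounded linear operator on $X^S$. Write $e_i(t)=t^i$ for $i=0,1,2$, and suppose: (1) $A(e_0)A(e_2)=[A(e_1)]^2$ and $A(e_0)(t)>0$ for every $t\in[0,1]$; (2) $\lim_{n\to\infty}L_n(g)=A(g)$ in $C[0,1]$ for all $g\in\{e_0,e_1,e_2\}$. Then $\lim_{n\to\infty}L_n(f)=A(f)$ in $X$ for all $f\in X^S$ if and only if $\sup_n\|L_n\|_{B(X^S)}<\infty$.
   Context: Work on $[0,1]$ with the Borel $\sigma$-algebra $\mathcal{S}$ and Lebesgue measure $\mu$. Let $\mathcal{M}$ be the set of real-valued measurable functions on $[0,1]$ (identified when equal a.e.) and $\mathcal{M}^+$ the non-negative ones. A map $\rho:\mathcal{M}^+\to[0,+\infty]$ is a function norm if for all $f,g,f_n\in\mathcal{M}^+$, $a\ge 0$, $E\in\mathcal{S}$: (i) $\rho(f)=0\iff f=0$ a.e., $\rho(af)=a\rho(f)$, $\rho(f+g)\le\rho(f)+\rho(g)$; (ii) $g\le f$ a.e. implies $\rho(g)\le\rho(f)$; (iii) $f_n\uparrow f$ a.e. implies $\rho(f_n)\uparrow\rho(f)$; (iv) $\mu(E)<\infty$ implies $\rho(\chi_E)<\infty$; (v) $\mu(E)<\infty$ implies there is $C_E>0$, depending only on $E$ and $\rho$, with $\int_E f\,d\mu\le C_E\rho(f)$. The Banach function space $X$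 generated by $\rho$ is the space of $f\in\mathcal{M}$ with $\|f\|_X:=\rho(|f|)<\infty$. A function $f\in X$ has absolutely continuous norm if $\|f\chi_{E_n}\|_X\to0$ for every sequence $E_n\in\mathcal{S}$ with $E_n\to\emptyset$ a.e. (i.e. $\chi_{E_n}\to0$ a.e.); $X_a$ is the set of all such $f$. Here $1$ is the constant function. For $\delta>0$, $T_\delta f(x)=f(x+\delta)$ if $x+\delta\in[0,1]$ and $T_\delta f(x)=0$ otherwise. $X^S$ is the closure in $X$ of $\{f\in X:\lim_{\delta\to0}\|T_\delta f-f\|_X=0\}$, with the norm of $X$. When $1\in X_a$ one has $C[0,1]\subset X^S$. A linear operator $L$ on $X^S$ is positive if $f\ge0$ a.e. implies $L(f)\ge0$ a.e. $C[0,1]$ carries the sup-norm $\|\cdot\|_\infty$, and "$L_n(g)\to A(g)$ in $C[0,1]$" means $L_n(g),A(g)\in C[0,1]$ and $\|L_n(g)-A(g)\|_\infty\to0$. $\|\cdot\|_{B(X^S)}$ is the operator norm on bounded linear operators $X^S\to X^S$. *)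

theory Defs
  imports "HOL-Analysis.Analysis"
begin

text \<open>
  Elements of the function spaces below are represented by functions, not by classes modulo
  a.e. equality: all order relations and equations between them are required almost everywhere
  only, and values outside the unit interval play no role.
\<close>

definition unit_measure :: "real measure" where
  "unit_measure = restrict_space lborel {0..1}"

definition meas_nonneg :: "(real \<Rightarrow> real) set" where
  "meas_nonneg = {f \<in> borel_measurable unit_measure. AE x in unit_measure. 0 \<le> f x}"

definition function_norm :: "((real \<Rightarrow> real) \<Rightarrow> ennreal) \<Rightarrow> bool" where
  "function_norm \<rho> \<longleftrightarrow>
     (\<forall>f\<in>meas_nonneg. \<rho> f = 0 \<longleftrightarrow> (AE x in unit_measure. f x = 0)) \<and>
     (\<forall>f\<in>meas_nonneg. \<forall>a\<ge>0. \<rho> (\<lambda>x. a * f x) = ennreal a * \<rho> f) \<and>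
     (\<forall>f\<in>meas_nonneg. \<forall>g\<in>meas_nonneg. \<rho> (\<lambda>x. f x + g x) \<le> \<rho> f + \<rho> g) \<and>
     (\<forall>f\<in>meas_nonneg. \<forall>g\<in>meas_nonneg.
        (AE x in unit_measure. g x \<le> f x) \<longrightarrow> \<rho> g \<le> \<rho> f) \<and>
     (\<forall>F f. (\<forall>n::nat. F n \<in> meas_nonneg) \<longrightarrow> f \<in> meas_nonneg \<longrightarrow>
        (AE x in unit_measure. incseq (\<lambda>n. F n x) \<and> (\<lambda>n. F n x) \<longlonglongrightarrow> f x) \<longrightarrow>
        incseq (\<lambda>n. \<rho> (F n)) \<and> (\<lambda>n. \<rho> (F n)) \<longlonglongrightarrow> \<rho> f) \<and>
     (\<forall>E\<in>sets unit_measure. emeasure unit_measure E < \<infinity> \<longrightarrow> \<rho> (indicator E) < \<infinity>) \<and>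
     (\<forall>E\<in>sets unit_measure. emeasure unit_measure E < \<infinity> \<longrightarrow>
        (\<exists>C::real. C > 0 \<and> (\<forall>f\<in>meas_nonneg.
           (\<integral>\<^sup>+x\<in>E. ennreal (f x) \<partial>unit_measure) \<le> ennreal C * \<rho> f)))"

text \<open>
  The norm is kept extended-valued, so that a convergence such as
  \<open>bfs_norm \<rho> (T\<^sub>\<delta> f - f) \<longlonglongrightarrow> 0\<close> is meaningful (and not satisfied by
  accident) when the argument does not lie in the space.
\<close>

definition bfs_norm :: "((real \<Rightarrow> real) \<Rightarrow> ennreal) \<Rightarrow> (real \<Rightarrow> real) \<Rightarrow> ennreal" where
  "bfs_norm \<rho> f = \<rho> (\<lambda>x. \<bar>f x\<bar>)"

definition bfs :: "((real \<Rightarrow> real) \<Rightarrow> ennreal) \<Rightarrow> (real \<Rightarrow> real) set" where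
  "bfs \<rho> = {f \<in> borel_measurable unit_measure. bfs_norm \<rho> f < \<infinity>}"

definition bfs_ac :: "((real \<Rightarrow> real) \<Rightarrow> ennreal) \<Rightarrow> (real \<Rightarrow> real) set" where
  "bfs_ac \<rho> = {f \<in> bfs \<rho>. \<forall>E. (\<forall>n::nat. E n \<in> sets unit_measure) \<longrightarrow>
     (AE x in unit_measure. (\<lambda>n. indicator (E n) x :: real) \<longlonglongrightarrow> 0) \<longrightarrow>
     (\<lambda>n. bfs_norm \<rho> (\<lambda>x. f x * indicator (E n) x)) \<longlonglongrightarrow> 0}"

definition shift :: "real \<Rightarrow> (real \<Rightarrow> real) \<Rightarrow> real \<Rightarrow> real" where
  "shift \<delta> f x = (if x + \<delta> \<in> {0..1} then f (x + \<delta>) else 0)"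

text \<open>The space \<open>X\<^sup>S\<close>; translations are only taken for \<open>\<delta> > 0\<close>, hence the right-sided limit.\<close>

definition bfs_shift :: "((real \<Rightarrow> real) \<Rightarrow> ennreal) \<Rightarrow> (real \<Rightarrow> real) set" where
  "bfs_shift \<rho> = {f \<in> bfs \<rho>. \<forall>\<epsilon>>0. \<exists>g\<in>bfs \<rho>.
     ((\<lambda>\<delta>. bfs_norm \<rho> (\<lambda>x. shift \<delta> g x - g x)) \<longlongrightarrow> 0) (at_right 0) \<and>
     bfs_norm \<rho> (\<lambda>x. f x - g x) < \<epsilon>}"

text \<open>The second conjunct says that the operator is well defined on a.e. classes.\<close>

definition linear_operator ::
  "((real \<Rightarrow> real) \<Rightarrow> ennreal) \<Rightarrow> ((real \<Rightarrow> real) \<Rightarrow> real \<Rightarrow> real) \<Rightarrow> bool" where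
  "linear_operator \<rho> L \<longleftrightarrow>
     (\<forall>f\<in>bfs_shift \<rho>. L f \<in> bfs_shift \<rho>) \<and>
     (\<forall>f\<in>bfs_shift \<rho>. \<forall>g\<in>bfs_shift \<rho>.
        (AE x in unit_measure. f x = g x) \<longrightarrow> (AE x in unit_measure. L f x = L g x)) \<and>
     (\<forall>f\<in>bfs_shift \<rho>. \<forall>g\<in>bfs_shift \<rho>.
        AE x in unit_measure. L (\<lambda>t. f t + g t) x = L f x + L g x) \<and>
     (\<forall>f\<in>bfs_shift \<rho>. \<forall>c. AE x in unit_measure. L (\<lambda>t. c * f t) x = c * L f x)"

definition bounded_linear_operator ::
  "((real \<Rightarrow> real) \<Rightarrow> ennreal) \<Rightarrow> ((real \<Rightarrow> real) \<Rightarrow> real \<Rightarrow> real) \<Rightarrow> bool" where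
  "bounded_linear_operator \<rho> L \<longleftrightarrow> linear_operator \<rho> L \<and>
     (\<exists>K::real. \<forall>f\<in>bfs_shift \<rho>. bfs_norm \<rho> (L f) \<le> ennreal K * bfs_norm \<rho> f)"

definition positive_operator ::
  "((real \<Rightarrow> real) \<Rightarrow> ennreal) \<Rightarrow> ((real \<Rightarrow> real) \<Rightarrow> real \<Rightarrow> real) \<Rightarrow> bool" where
  "positive_operator \<rho> L \<longleftrightarrow> (\<forall>f\<in>bfs_shift \<rho>.
     (AE x in unit_measure. 0 \<le> f x) \<longrightarrow> (AE x in unit_measure. 0 \<le> L f x))"

definition operator_norm ::
  "((real \<Rightarrow> real) \<Rightarrow> ennreal) \<Rightarrow> ((real \<Rightarrow> real) \<Rightarrow> real \<Rightarrow> real) \<Rightarrow> ennreal" where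
  "operator_norm \<rho> L = (SUP f\<in>{f \<in> bfs_shift \<rho>. bfs_norm \<rho> f \<le> 1}. bfs_norm \<rho> (L f))"

text \<open>
  An a.e. class belongs to \<open>C[0,1]\<close> if it contains a function that is continuous on the unit
  interval. The values of such a function on the unit interval are uniquely determined by the
  class, so there is no ambiguity in \<open>cont_version f t\<close> for \<open>t \<in> {0..1}\<close>.
\<close>

definition in_C01 :: "(real \<Rightarrow> real) \<Rightarrow> bool" where
  "in_C01 f \<longleftrightarrow> (\<exists>h. continuous_on {0..1} h \<and> (AE x in unit_measure. f x = h x))"

definition cont_version :: "(real \<Rightarrow> real) \<Rightarrow> real \<Rightarrow> real" where
  "cont_version f = (SOME h. continuous_on {0..1} h \<and> (AE x in unit_measure. f x = h x))"

definition C01_norm :: "(real \<Rightarrow> real) \<Rightarrow> real" where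
  "C01_norm h = (SUP t\<in>{0..1}. \<bar>h t\<bar>)"

definition converges_in_C01 :: "(nat \<Rightarrow> real \<Rightarrow> real) \<Rightarrow> (real \<Rightarrow> real) \<Rightarrow> bool" where
  "converges_in_C01 F f \<longleftrightarrow> (\<forall>n. in_C01 (F n)) \<and> in_C01 f \<and>
     (\<lambda>n. C01_norm (\<lambda>t. cont_version (F n) t - cont_version f t)) \<longlonglongrightarrow> 0"

definition converges_in_bfs ::
  "((real \<Rightarrow> real) \<Rightarrow> ennreal) \<Rightarrow> (nat \<Rightarrow> real \<Rightarrow> real) \<Rightarrow> (real \<Rightarrow> real) \<Rightarrow> bool" where
  "converges_in_bfs \<rho> F f \<longleftrightarrow> (\<lambda>n. bfs_norm \<rho> (\<lambda>x. F n x - f x)) \<longlonglongrightarrow> 0"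

definition monomial :: "nat \<Rightarrow> real \<Rightarrow> real" where
  "monomial i t = t ^ i"

end

theory Submission
  imports Defs
begin

text \<open>
  Sufficiency. If \<open>g\<close> has continuous translations, its Steklov means
  \<open>x \<mapsto> (1/h) \<integral> {x..x+h} g\<close> are continuous and, as limits of averages of translates, close to
  \<open>g\<close> in norm; hence \<open>C[0,1]\<close> is dense in \<open>X\<^sup>S\<close> and, by uniform boundedness, it suffices to treat
  continuous \<open>\<phi>\<close>. Korovkin's argument applies \<open>L n\<close> and \<open>A\<close> to
  \<open>\<bar>\<phi> t - \<phi> u\<bar> \<le> \<epsilon> + C (t - u)\<^sup>2\<close>. Evaluated at \<open>x\<close> with
  \<open>u = A e\<^sub>1 x / A e\<^sub>0 x\<close>, the quadratic term tends to
  \<open>C (A e\<^sub>2 x - (A e\<^sub>1 x)\<^sup>2 / A e\<^sub>0 x) = 0\<close> uniformly in \<open>x\<close>, so that both \<open>L n \<phi>\<close> and \<open>A \<phi>\<close> are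
  uniformly close to \<open>\<phi> u * A e\<^sub>0\<close>. As the operators act on a.e. classes, the estimate is first
  taken for all rational \<open>u\<close> simultaneously.

  Necessity. If the operator norms were unbounded, a norm-convergent series of non-negative functions
  would yield, by positivity, some \<open>f \<in> X\<^sup>S\<close> with unbounded \<open>L n f\<close>.
\<close>

section \<open>The unit interval as a measure space, and null limits of extended reals\<close>

lemma space_unit_measure [simp]: "space unit_measure = {0..1}"
  by (simp add: unit_measure_def)

lemma emeasure_unit_measure: "emeasure unit_measure (space unit_measure) = 1"
  unfolding space_unit_measure by (simp add: unit_measure_def emeasure_restrict_space)

lemma borel_measurable_unit_measureI:
  "f \<in> borel_measurable borel \<Longrightarrow> f \<in> borel_measurable unit_measure"
  unfolding unit_measure_def by (rule measurable_restrict_space1) simp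

text \<open>The extension by zero to the real line is the form in which translates, which leave the
  unit interval, can be handled.\<close>

lemma borel_measurable_unit_measure_iff:
  "(f :: real \<Rightarrow> real) \<in> borel_measurable unit_measure
     \<longleftrightarrow> (\<lambda>x. indicator {0..1} x * f x) \<in> borel_measurable borel"
  unfolding unit_measure_def by (subst borel_measurable_restrict_space_iff) auto

lemma AE_unit_measure_iff:
  "(AE x in unit_measure. P x) \<longleftrightarrow> (AE x in lborel. x \<in> {0..1} \<longrightarrow> P x)"
  unfolding unit_measure_def by (simp add: AE_restrict_space_iff)

lemma continuous_on_borel_measurable_unit_measure:
  "continuous_on {0..1} (f :: real \<Rightarrow> real) \<Longrightarrow> f \<in> borel_measurable unit_measure"
  unfolding borel_measurable_unit_measure_iff
  using borel_measurable_continuous_on_indicator[of "{0..1}" f] by simp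

text \<open>Below every positive extended real lies a positive finite one, so real bounds
  suffice.\<close>

lemma ennreal_tendsto_0I:
  fixes F :: "'b \<Rightarrow> ennreal"
  assumes "\<And>e::real. e > 0 \<Longrightarrow> eventually (\<lambda>x. F x \<le> ennreal e) net"
  shows "(F \<longlongrightarrow> 0) net"
proof (rule order_tendstoI)
  fix a :: ennreal assume "0 < a"
  then obtain b where b: "0 < b" "b < a" using dense by blast
  then have "b < top" by (simp add: less_top[symmetric]) (metis top.not_eq_extremum top.extremum_strict)
  then obtain e where e: "b = ennreal e" "e \<ge> 0" by (cases b) auto
  with b have "e > 0" by (cases "e = 0") auto
  from assms[OF this] show "eventually (\<lambda>x. F x < a) net"
    by eventually_elim (use b e in auto)
qed auto

lemma ennreal_tendsto_0D:
  fixes F :: "'b \<Rightarrow> ennreal"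
  assumes "(F \<longlongrightarrow> 0) net" "e > 0"
  shows "eventually (\<lambda>x. F x \<le> ennreal e) net"
  using order_tendstoD(2)[OF assms(1), of "ennreal e"] assms(2)
  by (auto elim!: eventually_mono)

section \<open>Elementary properties of the norm, its L1 bound and Fatou's property\<close>

locale banach_function_norm =
  fixes \<rho> :: "(real \<Rightarrow> real) \<Rightarrow> ennreal"
  assumes function_norm: "function_norm \<rho>"
begin

abbreviation N :: "(real \<Rightarrow> real) \<Rightarrow> ennreal" where "N \<equiv> bfs_norm \<rho>"
abbreviation X :: "(real \<Rightarrow> real) set" where "X \<equiv> bfs \<rho>"
abbreviation XS :: "(real \<Rightarrow> real) set" where "XS \<equiv> bfs_shift \<rho>"

lemma norm_scale: "f \<in> meas_nonneg \<Longrightarrow> a \<ge> 0 \<Longrightarrow> \<rho> (\<lambda>x. a * f x) = ennreal a * \<rho> f"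
  and norm_add: "f \<in> meas_nonneg \<Longrightarrow> g \<in> meas_nonneg \<Longrightarrow> \<rho> (\<lambda>x. f x + g x) \<le> \<rho> f + \<rho> g"
  and norm_mono: "f \<in> meas_nonneg \<Longrightarrow> g \<in> meas_nonneg \<Longrightarrow>
        AE x in unit_measure. g x \<le> f x \<Longrightarrow> \<rho> g \<le> \<rho> f"
  and norm_L1: "E \<in> sets unit_measure \<Longrightarrow> emeasure unit_measure E < \<infinity> \<Longrightarrow>
        \<exists>C::real. C > 0 \<and> (\<forall>f\<in>meas_nonneg.
           (\<integral>\<^sup>+x\<in>E. ennreal (f x) \<partial>unit_measure) \<le> ennreal C * \<rho> f)"
  using function_norm unfolding function_norm_def by blast+

lemma norm_monotone_convergence:
  assumes "\<And>n::nat. F n \<in> meas_nonneg" "f \<in> meas_nonneg"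
    "AE x in unit_measure. incseq (\<lambda>n. F n x) \<and> (\<lambda>n. F n x) \<longlonglongrightarrow> f x"
  shows "(\<lambda>n. \<rho> (F n)) \<longlonglongrightarrow> \<rho> f"
  using function_norm assms unfolding function_norm_def by blast

lemma abs_meas_nonneg:
  "f \<in> borel_measurable unit_measure \<Longrightarrow> (\<lambda>x. \<bar>f x\<bar>) \<in> meas_nonneg"
  by (auto simp: meas_nonneg_def)

lemma N_mono:
  assumes "f \<in> borel_measurable unit_measure" "g \<in> borel_measurable unit_measure"
    "AE x in unit_measure. \<bar>f x\<bar> \<le> \<bar>g x\<bar>"
  shows "N f \<le> N g"
  unfolding bfs_norm_def using assms by (intro norm_mono abs_meas_nonneg)

lemma N_cong:
  assumes "f \<in> borel_measurable unit_measure" "g \<in> borel_measurable unit_measure"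
    "AE x in unit_measure. f x = g x"
  shows "N f = N g"
  by (intro antisym N_mono) (use assms in auto)

lemma N_scale: "f \<in> borel_measurable unit_measure \<Longrightarrow> N (\<lambda>x. c * f x) = ennreal \<bar>c\<bar> * N f"
  unfolding bfs_norm_def by (simp add: abs_mult norm_scale abs_meas_nonneg)

lemma N_minus: "N (\<lambda>x. - f x) = N f"
  by (simp add: bfs_norm_def)

lemma N_minus_commute: "N (\<lambda>x. f x - g x) = N (\<lambda>x. g x - f x)"
  by (simp add: bfs_norm_def abs_minus_commute)

lemma N_0: "N (\<lambda>x. 0) = 0"
  using N_scale[of "\<lambda>x. 0" 0] by simp

lemma N_add:
  assumes "f \<in> borel_measurable unit_measure" "g \<in> borel_measurable unit_measure"
  shows "N (\<lambda>x. f x + g x) \<le> N f + N g"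
proof -
  have "N (\<lambda>x. f x + g x) \<le> N (\<lambda>x. \<bar>f x\<bar> + \<bar>g x\<bar>)"
    using assms by (intro N_mono) auto
  also have "\<dots> = \<rho> (\<lambda>x. \<bar>f x\<bar> + \<bar>g x\<bar>)"
    by (simp add: bfs_norm_def)
  also have "\<dots> \<le> N f + N g"
    unfolding bfs_norm_def using assms by (intro norm_add abs_meas_nonneg)
  finally show ?thesis .
qed

lemma N_triangle:
  assumes "f \<in> borel_measurable unit_measure" "g \<in> borel_measurable unit_measure"
    "h \<in> borel_measurable unit_measure"
  shows "N (\<lambda>x. f x - h x) \<le> N (\<lambda>x. f x - g x) + N (\<lambda>x. g x - h x)"
  using N_add[of "\<lambda>x. f x - g x" "\<lambda>x. g x - h x"] assms by simp

lemma N_sum: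
  assumes "finite I" "\<And>i. i \<in> I \<Longrightarrow> f i \<in> borel_measurable unit_measure"
  shows "N (\<lambda>x. \<Sum>i\<in>I. f i x) \<le> (\<Sum>i\<in>I. N (f i))"
  using assms
proof (induction I rule: finite_induct)
  case (insert i I)
  have "N (\<lambda>x. \<Sum>i\<in>insert i I. f i x) = N (\<lambda>x. f i x + (\<Sum>i\<in>I. f i x))"
    using insert by simp
  also have "\<dots> \<le> N (f i) + N (\<lambda>x. \<Sum>i\<in>I. f i x)"
    using insert by (intro N_add borel_measurable_sum) auto
  also have "\<dots> \<le> N (f i) + (\<Sum>i\<in>I. N (f i))"
    using insert by (intro add_mono) auto
  finally show ?case using insert by simp
qed (simp add: N_0)

text \<open>Axiom (v) for the whole interval, which has finite measure: \<open>X\<close> embeds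
  continuously into L1. Integrability and a.e. summability are drawn from this later.\<close>

lemma N_L1:
  obtains C :: real where "C > 0"
    "\<And>f. f \<in> borel_measurable unit_measure \<Longrightarrow>
       (\<integral>\<^sup>+x. ennreal \<bar>f x\<bar> \<partial>unit_measure) \<le> ennreal C * N f"
proof -
  obtain C :: real where C: "C > 0" "\<forall>f\<in>meas_nonneg.
      (\<integral>\<^sup>+x\<in>space unit_measure. ennreal (f x) \<partial>unit_measure) \<le> ennreal C * \<rho> f"
    using norm_L1[of "space unit_measure"] emeasure_unit_measure by (auto simp del: space_unit_measure)
  show ?thesis
  proof (rule that[OF C(1)])
    fix f :: "real \<Rightarrow> real" assume "f \<in> borel_measurable unit_measure"
    moreover have "(\<integral>\<^sup>+x. ennreal \<bar>f x\<bar> \<partial>unit_measure)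
        = (\<integral>\<^sup>+x\<in>space unit_measure. ennreal \<bar>f x\<bar> \<partial>unit_measure)"
      by (intro nn_integral_cong) auto
    ultimately show "(\<integral>\<^sup>+x. ennreal \<bar>f x\<bar> \<partial>unit_measure) \<le> ennreal C * N f"
      using C(2) abs_meas_nonneg[of f] by (simp add: bfs_norm_def)
  qed
qed

text \<open>Axiom (iii) speaks of increasing sequences only. The infima of
  \<open>\<bar>u k x\<bar>\<close> over \<open>k \<ge> n\<close> increase to
  \<open>\<bar>f x\<bar>\<close> a.e. and lie below \<open>\<bar>u n x\<bar>\<close>, so their norms
  are at most \<open>e\<close>.\<close>

lemma N_Fatou:
  assumes u [measurable]: "\<And>k::nat. u k \<in> borel_measurable unit_measure"
    and f [measurable]: "f \<in> borel_measurable unit_measure"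
    and lim: "AE x in unit_measure. (\<lambda>k. u k x) \<longlonglongrightarrow> f x"
    and le: "\<And>k. N (u k) \<le> e"
  shows "N f \<le> e"
proof -
  define v where "v n x = (INF k\<in>{n..}. \<bar>u k x\<bar>)" for n x
  have bdd: "bdd_below ((\<lambda>k. \<bar>u k x\<bar>) ` {n..})" for n x
    by (rule bdd_belowI2[of _ 0]) auto
  have v_meas [measurable]: "v n \<in> borel_measurable unit_measure" for n
    unfolding v_def by measurable
  have v_nonneg: "v n x \<ge> 0" for n x
    unfolding v_def by (rule cINF_greatest) auto
  have v_le: "v n x \<le> \<bar>u k x\<bar>" if "n \<le> k" for n k x
    unfolding v_def using that by (intro cINF_lower bdd) auto
  have v_pos: "v n \<in> meas_nonneg" for n
    using v_nonneg by (auto simp: meas_nonneg_def)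
  have "(\<lambda>n. \<rho> (v n)) \<longlonglongrightarrow> \<rho> (\<lambda>x. \<bar>f x\<bar>)"
  proof (rule norm_monotone_convergence)
    show "AE x in unit_measure. incseq (\<lambda>n. v n x) \<and> (\<lambda>n. v n x) \<longlonglongrightarrow> \<bar>f x\<bar>"
      using lim
    proof eventually_elim
      case (elim x)
      then have *: "(\<lambda>k. \<bar>u k x\<bar>) \<longlonglongrightarrow> \<bar>f x\<bar>" by (rule tendsto_rabs)
      have "incseq (\<lambda>n. v n x)"
        unfolding v_def by (intro incseq_SucI cINF_superset_mono bdd) auto
      moreover have "(\<lambda>n. v n x) \<longlonglongrightarrow> \<bar>f x\<bar>"
      proof (rule LIMSEQ_I)
        fix r :: real assume "r > 0"
        then obtain n0 where n0: "\<And>k. k \<ge> n0 \<Longrightarrow> \<bar>\<bar>u k x\<bar> - \<bar>f x\<bar>\<bar> < r/2"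
          using LIMSEQ_D[OF *, of "r/2"] by auto
        have "norm (v n x - \<bar>f x\<bar>) < r" if "n \<ge> n0" for n
        proof -
          have "\<bar>f x\<bar> - r/2 \<le> v n x"
            unfolding v_def
          proof (rule cINF_greatest)
            fix k assume "k \<in> {n..}"
            with n0[of k] that show "\<bar>f x\<bar> - r/2 \<le> \<bar>u k x\<bar>" by (auto simp: abs_if split: if_splits)
          qed auto
          moreover have "v n x \<le> \<bar>f x\<bar> + r/2"
            using v_le[of n n x] n0[of n] that by linarith
          ultimately show ?thesis using \<open>r > 0\<close> by (auto simp: abs_if)
        qed
        then show "\<exists>no. \<forall>n\<ge>no. norm (v n x - \<bar>f x\<bar>) < r" by blast
      qed
      ultimately show ?case ..
    qed
  qed (use v_pos abs_meas_nonneg f in auto)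
  moreover have "\<rho> (v n) \<le> e" for n
  proof -
    have "\<rho> (v n) \<le> N (u n)"
      unfolding bfs_norm_def by (rule norm_mono) (use v_pos v_le abs_meas_nonneg u in auto)
    with le[of n] show ?thesis by simp
  qed
  ultimately show ?thesis unfolding bfs_norm_def by (intro LIMSEQ_le_const2[of _ _ e]) auto
qed

subsection \<open>Translation-continuous functions\<close>

lemma X_measurable [measurable_dest]: "f \<in> X \<Longrightarrow> f \<in> borel_measurable unit_measure"
  by (simp add: bfs_def)

lemma X_finite: "f \<in> X \<Longrightarrow> N f < \<infinity>"
  by (simp add: bfs_def)

lemma XS_subset_X: "f \<in> XS \<Longrightarrow> f \<in> X"
  by (simp add: bfs_shift_def)

lemma XS_measurable [measurable_dest]: "f \<in> XS \<Longrightarrow> f \<in> borel_measurable unit_measure"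
  by (intro X_measurable XS_subset_X)

lemma XS_finite: "f \<in> XS \<Longrightarrow> N f < \<infinity>"
  by (intro X_finite XS_subset_X)

lemma X_add: "f \<in> X \<Longrightarrow> g \<in> X \<Longrightarrow> (\<lambda>x. f x + g x) \<in> X"
  using N_add[of f g] by (auto simp: bfs_def intro: le_less_trans)

lemma X_scale: "f \<in> X \<Longrightarrow> (\<lambda>x. c * f x) \<in> X"
  using N_scale[of f c] by (auto simp: bfs_def intro: ennreal_mult_less_top[THEN iffD2])

lemma X_abs: "f \<in> X \<Longrightarrow> (\<lambda>x. \<bar>f x\<bar>) \<in> X"
  by (auto simp: bfs_def bfs_norm_def)

text \<open>The translation-continuous functions before closure; \<open>XS\<close> is the closure of
  this set in \<open>X\<close>, see \<open>XS_iff\<close>.\<close>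

definition S0 :: "(real \<Rightarrow> real) set" where
  "S0 = {g \<in> X. ((\<lambda>\<delta>. N (\<lambda>x. shift \<delta> g x - g x)) \<longlongrightarrow> 0) (at_right 0)}"

lemma XS_iff: "f \<in> XS \<longleftrightarrow> f \<in> X \<and> (\<forall>\<epsilon>>0. \<exists>g\<in>S0. N (\<lambda>x. f x - g x) < \<epsilon>)"
  by (auto simp: bfs_shift_def S0_def)

lemma S0_subset_X: "f \<in> S0 \<Longrightarrow> f \<in> X"
  by (simp add: S0_def)

lemma shift_measurable [measurable]:
  assumes "f \<in> borel_measurable unit_measure"
  shows "shift \<delta> f \<in> borel_measurable unit_measure"
proof -
  have *: "(\<lambda>x. indicator {0..1} x * f x) \<in> borel_measurable borel"
    using assms borel_measurable_unit_measure_iff by blast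
  have "shift \<delta> f = (\<lambda>x. indicator {0..1} (x + \<delta>) * f (x + \<delta>))"
    by (auto simp: shift_def fun_eq_iff indicator_def)
  also have "\<dots> \<in> borel_measurable borel"
    by (rule measurable_compose[OF _ *]) simp
  finally show ?thesis by (rule borel_measurable_unit_measureI)
qed

text \<open>Serves the closure properties below: \<open>shift\<close> commutes with pointwise
  operations that fix 0, so each of them comes with an explicit majorant of the translation
  error.\<close>

lemma S0I:
  assumes "g \<in> X"
    and "((\<lambda>\<delta>. b \<delta>) \<longlongrightarrow> 0) (at_right 0)"
    and "\<And>\<delta>. N (\<lambda>x. shift \<delta> g x - g x) \<le> b \<delta>"
  shows "g \<in> S0"
proof -
  have "((\<lambda>\<delta>. N (\<lambda>x. shift \<delta> g x - g x)) \<longlongrightarrow> 0) (at_right 0)"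
    by (rule tendsto_sandwich[OF _ _ tendsto_const assms(2)]) (use assms(3) in auto)
  with assms(1) show ?thesis by (simp add: S0_def)
qed

lemma S0_tendsto: "g \<in> S0 \<Longrightarrow> ((\<lambda>\<delta>. N (\<lambda>x. shift \<delta> g x - g x)) \<longlongrightarrow> 0) (at_right 0)"
  by (simp add: S0_def)

lemma S0_add:
  assumes "f \<in> S0" "g \<in> S0"
  shows "(\<lambda>x. f x + g x) \<in> S0"
proof (rule S0I)
  have [measurable]: "f \<in> borel_measurable unit_measure" "g \<in> borel_measurable unit_measure"
    using assms X_measurable S0_subset_X by auto
  show "((\<lambda>\<delta>. N (\<lambda>x. shift \<delta> f x - f x) + N (\<lambda>x. shift \<delta> g x - g x)) \<longlongrightarrow> 0) (at_right 0)"
    using tendsto_add[OF S0_tendsto[OF assms(1)] S0_tendsto[OF assms(2)]] by simp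
  fix \<delta>
  have "(\<lambda>x. shift \<delta> (\<lambda>x. f x + g x) x - (f x + g x))
      = (\<lambda>x. (shift \<delta> f x - f x) + (shift \<delta> g x - g x))"
    by (auto simp: shift_def)
  then show "N (\<lambda>x. shift \<delta> (\<lambda>x. f x + g x) x - (f x + g x))
      \<le> N (\<lambda>x. shift \<delta> f x - f x) + N (\<lambda>x. shift \<delta> g x - g x)"
    by (simp only:) (rule N_add; measurable)
qed (use assms S0_subset_X X_add in auto)

lemma S0_scale:
  assumes "f \<in> S0"
  shows "(\<lambda>x. c * f x) \<in> S0"
proof (rule S0I)
  have [measurable]: "f \<in> borel_measurable unit_measure"
    using assms X_measurable S0_subset_X by auto
  show "((\<lambda>\<delta>. ennreal \<bar>c\<bar> * N (\<lambda>x. shift \<delta> f x - f x)) \<longlongrightarrow> 0) (at_right 0)"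
    using ennreal_tendsto_cmult[OF _ S0_tendsto[OF assms], of "ennreal \<bar>c\<bar>"] by simp
  fix \<delta>
  have "(\<lambda>x. shift \<delta> (\<lambda>x. c * f x) x - c * f x) = (\<lambda>x. c * (shift \<delta> f x - f x))"
    by (auto simp: shift_def algebra_simps)
  then show "N (\<lambda>x. shift \<delta> (\<lambda>x. c * f x) x - c * f x) \<le> ennreal \<bar>c\<bar> * N (\<lambda>x. shift \<delta> f x - f x)"
    by (simp only:) (rule eq_refl, rule N_scale, measurable)
qed (use assms S0_subset_X X_scale in auto)

text \<open>The reverse triangle inequality, as \<open>shift\<close> commutes with the modulus.
  Through \<open>XS_abs\<close> it makes the moduli in the necessity argument admissible.\<close>

lemma S0_abs:
  assumes "f \<in> S0"
  shows "(\<lambda>x. \<bar>f x\<bar>) \<in> S0"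
proof (rule S0I)
  have [measurable]: "f \<in> borel_measurable unit_measure"
    using assms X_measurable S0_subset_X by auto
  show "((\<lambda>\<delta>. N (\<lambda>x. shift \<delta> f x - f x)) \<longlongrightarrow> 0) (at_right 0)"
    by (rule S0_tendsto[OF assms])
  fix \<delta>
  show "N (\<lambda>x. shift \<delta> (\<lambda>x. \<bar>f x\<bar>) x - \<bar>f x\<bar>) \<le> N (\<lambda>x. shift \<delta> f x - f x)"
  proof (intro N_mono)
    have "shift \<delta> (\<lambda>x. \<bar>f x\<bar>) \<in> borel_measurable unit_measure"
      by (intro shift_measurable) measurable
    then show "(\<lambda>x. shift \<delta> (\<lambda>x. \<bar>f x\<bar>) x - \<bar>f x\<bar>) \<in> borel_measurable unit_measure"
      by measurable
  qed (measurable, auto simp: shift_def)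
qed (use assms S0_subset_X X_abs in auto)

lemma XS_closed:
  assumes f: "f \<in> borel_measurable unit_measure"
    and approx: "\<And>e::real. e > 0 \<Longrightarrow> \<exists>g\<in>XS. N (\<lambda>x. f x - g x) \<le> ennreal e"
  shows "f \<in> XS"
  unfolding XS_iff
proof (intro conjI allI impI)
  \<comment> \<open>As \<open>f\<close> is only assumed measurable, one approximant at finite
    distance is used to show that its norm is finite.\<close>
  obtain g where g: "g \<in> XS" "N (\<lambda>x. f x - g x) \<le> ennreal 1" using approx[of 1] by auto
  have "N f \<le> N (\<lambda>x. f x - g x) + N g"
    using N_add[of "\<lambda>x. f x - g x" g] f XS_measurable[OF g(1)] by simp
  also have "\<dots> < \<infinity>" using g(2) XS_finite[OF g(1)] by (auto intro: le_less_trans)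
  finally show "f \<in> X" using f by (simp add: bfs_def)
  fix \<epsilon> :: ennreal assume "\<epsilon> > 0"
  then obtain b where b: "0 < b" "b < \<epsilon>" using dense by blast
  then obtain e where e: "b = ennreal e" "e > 0" by (cases b) auto
  obtain g where g: "g \<in> XS" "N (\<lambda>x. f x - g x) \<le> ennreal (e/2)" using approx[of "e/2"] e by auto
  obtain h where h: "h \<in> S0" "N (\<lambda>x. g x - h x) < ennreal (e/2)"
    using g(1) e unfolding XS_iff by (metis ennreal_less_zero_iff half_gt_zero)
  have "N (\<lambda>x. f x - h x) \<le> N (\<lambda>x. f x - g x) + N (\<lambda>x. g x - h x)"
    using f XS_measurable[OF g(1)] X_measurable[OF S0_subset_X[OF h(1)]] by (rule N_triangle)
  also have "\<dots> \<le> ennreal (e/2) + ennreal (e/2)"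
    using g h by (intro add_mono) auto
  also have "\<dots> = b" using e by (simp flip: ennreal_plus)
  finally show "\<exists>h\<in>S0. N (\<lambda>x. f x - h x) < \<epsilon>" using h b by (auto intro: le_less_trans)
qed

lemma S0_subset_XS: "f \<in> S0 \<Longrightarrow> f \<in> XS"
  unfolding XS_iff by (auto simp: S0_subset_X N_0 intro!: bexI[of _ f])

lemma XS_approx: "f \<in> XS \<Longrightarrow> e > 0 \<Longrightarrow> \<exists>g\<in>S0. N (\<lambda>x. f x - g x) < ennreal e"
  unfolding XS_iff by (metis ennreal_less_zero_iff)

lemma XS_add:
  assumes f: "f \<in> XS" and g: "g \<in> XS"
  shows "(\<lambda>x. f x + g x) \<in> XS"
proof (rule XS_closed)
  show "(\<lambda>x. f x + g x) \<in> borel_measurable unit_measure"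
    using XS_measurable[OF f] XS_measurable[OF g] by simp
  fix e :: real assume e: "e > 0"
  obtain f' where f': "f' \<in> S0" "N (\<lambda>x. f x - f' x) < ennreal (e/2)"
    using XS_approx[OF f, of "e/2"] e by auto
  obtain g' where g': "g' \<in> S0" "N (\<lambda>x. g x - g' x) < ennreal (e/2)"
    using XS_approx[OF g, of "e/2"] e by auto
  have [measurable]: "f \<in> borel_measurable unit_measure" "g \<in> borel_measurable unit_measure"
    "f' \<in> borel_measurable unit_measure" "g' \<in> borel_measurable unit_measure"
    using f g f' g' X_measurable S0_subset_X XS_measurable by auto
  have "N (\<lambda>x. (f x + g x) - (f' x + g' x)) = N (\<lambda>x. (f x - f' x) + (g x - g' x))"
    by (simp add: algebra_simps)
  also have "\<dots> \<le> N (\<lambda>x. f x - f' x) + N (\<lambda>x. g x - g' x)"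
    by (rule N_add) auto
  also have "\<dots> \<le> ennreal (e/2) + ennreal (e/2)"
    using f' g' by (intro add_mono) auto
  also have "\<dots> = ennreal e" using e by (simp flip: ennreal_plus)
  finally show "\<exists>h\<in>XS. N (\<lambda>x. (f x + g x) - h x) \<le> ennreal e"
    using S0_subset_XS[OF S0_add[OF f'(1) g'(1)]] by (intro bexI[of _ "\<lambda>x. f' x + g' x"])
qed

lemma XS_scale:
  assumes f: "f \<in> XS"
  shows "(\<lambda>x. c * f x) \<in> XS"
proof (rule XS_closed)
  show m: "(\<lambda>x. c * f x) \<in> borel_measurable unit_measure" using XS_measurable[OF f] by simp
  fix e :: real assume e: "e > 0"
  \<comment> \<open>The 1 in the denominator covers \<open>c = 0\<close>.\<close>
  define d where "d = e / (\<bar>c\<bar> + 1)"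
  have d: "d > 0" "\<bar>c\<bar> * d \<le> e" using e by (auto simp: d_def field_simps)
  then obtain g where g: "g \<in> S0" "N (\<lambda>x. f x - g x) < ennreal d" using XS_approx[OF f] by blast
  have "N (\<lambda>x. c * f x - c * g x) = ennreal \<bar>c\<bar> * N (\<lambda>x. f x - g x)"
    using N_scale[of "\<lambda>x. f x - g x" c] XS_measurable[OF f] X_measurable[OF S0_subset_X[OF g(1)]]
    by (simp add: right_diff_distrib)
  also have "\<dots> \<le> ennreal \<bar>c\<bar> * ennreal d" using g by (intro mult_left_mono) auto
  also have "\<dots> \<le> ennreal e" using d by (simp flip: ennreal_mult add: ennreal_leI)
  finally show "\<exists>g\<in>XS. N (\<lambda>x. c * f x - g x) \<le> ennreal e"
    using S0_subset_XS[OF S0_scale[OF g(1), of c]] by (intro bexI[of _ "\<lambda>x. c * g x"])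
qed

lemma XS_abs:
  assumes f: "f \<in> XS"
  shows "(\<lambda>x. \<bar>f x\<bar>) \<in> XS"
proof (rule XS_closed)
  show "(\<lambda>x. \<bar>f x\<bar>) \<in> borel_measurable unit_measure" using XS_measurable[OF f] by simp
  fix e :: real assume e: "e > 0"
  then obtain g where g: "g \<in> S0" "N (\<lambda>x. f x - g x) < ennreal e" using XS_approx[OF f] by blast
  have "N (\<lambda>x. \<bar>f x\<bar> - \<bar>g x\<bar>) \<le> N (\<lambda>x. f x - g x)"
    using XS_measurable[OF f] X_measurable[OF S0_subset_X[OF g(1)]] by (intro N_mono) auto
  with g show "\<exists>g\<in>XS. N (\<lambda>x. \<bar>f x\<bar> - g x) \<le> ennreal e"
    using S0_subset_XS[OF S0_abs[OF g(1)]] by (intro bexI[of _ "\<lambda>x. \<bar>g x\<bar>"]) auto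
qed

lemma XS_diff: "f \<in> XS \<Longrightarrow> g \<in> XS \<Longrightarrow> (\<lambda>x. f x - g x) \<in> XS"
  using XS_add[of f "\<lambda>x. -1 * g x"] XS_scale[of g "-1"] by simp

lemma XS_0: "(\<lambda>x. 0) \<in> XS"
proof -
  have "(\<lambda>x. 0) \<in> S0"
    by (rule S0I[where b = "\<lambda>_. 0"]) (auto simp: bfs_def N_0 shift_def cong: if_cong)
  then show ?thesis by (rule S0_subset_XS)
qed

lemma XS_sum: "finite I \<Longrightarrow> (\<And>i. i \<in> I \<Longrightarrow> f i \<in> XS) \<Longrightarrow> (\<lambda>x. \<Sum>i\<in>I. f i x) \<in> XS"
  by (induction I rule: finite_induct) (auto simp: XS_0 intro!: XS_add)

end

subsection \<open>Steklov means and density of the continuous functions\<close>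

lemma nn_integral_unit_measure:
  assumes "f \<in> borel_measurable borel"
  shows "(\<integral>\<^sup>+x. f x \<partial>unit_measure) = (\<integral>\<^sup>+x. f x * indicator {0..1} x \<partial>lborel)"
  unfolding unit_measure_def using assms by (subst nn_integral_restrict_space) auto

definition steklov_primitive :: "(real \<Rightarrow> real) \<Rightarrow> real \<Rightarrow> real" where
  "steklov_primitive g0 x = (\<integral>y. indicator {..x} y * g0 y \<partial>lborel)"

text \<open>For \<open>h > 0\<close> this is the mean of \<open>g0\<close> over the window from
  \<open>x\<close> to \<open>x + h\<close>. As a difference quotient of a primitive it inherits the
  continuity of the primitive.\<close>

definition steklov :: "(real \<Rightarrow> real) \<Rightarrow> real \<Rightarrow> real \<Rightarrow> real" where
  "steklov g0 h x = (steklov_primitive g0 (x + h) - steklov_primitive g0 x) / h"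

text \<open>The L1 seminorm is taken over the half-line rather than the unit interval because
  \<open>x \<mapsto> x + a\<close> with \<open>a \<ge> 0\<close> maps the half-line into itself, so
  that passing to \<open>F (x + a)\<close> cannot increase it.\<close>

definition halfline_L1 :: "(real \<Rightarrow> real) \<Rightarrow> ennreal" where
  "halfline_L1 F = (\<integral>\<^sup>+x. indicator {0..} x * ennreal \<bar>F x\<bar> \<partial>lborel)"

text \<open>The left Riemann sum with \<open>n\<close> nodes for the Steklov mean over a window of
  length \<open>h\<close>.\<close>

definition translation_mean :: "(real \<Rightarrow> real) \<Rightarrow> real \<Rightarrow> nat \<Rightarrow> real \<Rightarrow> real" where
  "translation_mean g0 h n x = (\<Sum>j<n. g0 (x + real j * (h / n)) / n)"

lemma halfline_L1_translate:
  assumes [measurable]: "F \<in> borel_measurable borel" and a: "a \<ge> 0"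
  shows "halfline_L1 (\<lambda>x. F (x + a)) \<le> halfline_L1 F"
proof -
  have "halfline_L1 (\<lambda>x. F (x + a)) \<le> (\<integral>\<^sup>+x. indicator {0..} (a + 1 * x) * ennreal \<bar>F (a + 1 * x)\<bar> \<partial>lborel)"
    unfolding halfline_L1_def using a
    by (intro nn_integral_mono) (auto simp: indicator_def add.commute)
  also have "\<dots> = halfline_L1 F"
    unfolding halfline_L1_def by (subst nn_integral_real_affine[where c = 1 and t = a]) auto
  finally show ?thesis .
qed

locale steklov_mean =
  fixes g0 :: "real \<Rightarrow> real"
  assumes g0: "integrable lborel g0"
begin

lemma g0_measurable [measurable]: "g0 \<in> borel_measurable borel"
  using borel_measurable_integrable[OF g0] by simp

lemma integrable_indicator_g0: "integrable lborel (\<lambda>y. indicator {..x::real} y * g0 y)"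
  by (rule Bochner_Integration.integrable_bound[OF g0]) (auto simp: indicator_def)

lemma continuous_steklov_primitive: "continuous_on UNIV (steklov_primitive g0)"
proof (intro continuous_at_imp_continuous_on ballI)
  fix x :: real
  show "isCont (steklov_primitive g0) x"
    unfolding continuous_at_sequentially o_def
  proof (intro allI impI)
    fix u :: "nat \<Rightarrow> real" assume u: "u \<longlonglongrightarrow> x"
    show "(\<lambda>n. steklov_primitive g0 (u n)) \<longlonglongrightarrow> steklov_primitive g0 x"
      unfolding steklov_primitive_def
    proof (rule integral_dominated_convergence[where w = "\<lambda>y. \<bar>g0 y\<bar>"])
      \<comment> \<open>For \<open>y \<noteq> x\<close> the indicators are eventually constant in
        \<open>n\<close>, and the single point \<open>x\<close> is a null set.\<close>
      show "AE y in lborel. (\<lambda>n. indicator {..u n} y * g0 y) \<longlonglongrightarrow> indicator {..x} y * g0 y"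
        using AE_lborel_singleton[of x]
      proof eventually_elim
        case (elim y)
        have "eventually (\<lambda>n. indicator {..x} y * g0 y = indicator {..u n} y * g0 y) sequentially"
        proof (cases "y < x")
          case True
          from order_tendstoD(1)[OF u True] show ?thesis
            by eventually_elim (use True in auto)
        next
          case False
          with elim have "x < y" by auto
          from order_tendstoD(2)[OF u this] show ?thesis
            by eventually_elim (use \<open>x < y\<close> in auto)
        qed
        then show ?case by (rule tendsto_eventually[OF eventually_mono]) auto
      qed
    qed (use g0 in \<open>auto simp: indicator_def\<close>)
  qed
qed

lemma continuous_steklov: "continuous_on A (steklov g0 h)"
  unfolding steklov_def
  by (cases "h = 0")
     (auto intro!: continuous_intros continuous_on_compose2[OF continuous_steklov_primitive])

lemma steklov_measurable [measurable]: "steklov g0 h \<in> borel_measurable borel"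
  using continuous_steklov by (rule borel_measurable_continuous_onI)

lemma window_integrable:
  "integrable lborel (\<lambda>s. indicator {0<..h} s * g0 (x + s))"
  "integrable lborel (\<lambda>s. indicator {0<..h} s * g0 x)"
proof -
  have "integrable lborel (\<lambda>s. g0 (x + 1 * s))"
    using g0 by (subst lborel_integrable_real_affine_iff) auto
  then show "integrable lborel (\<lambda>s. indicator {0<..h} s * g0 (x + s))"
    by (rule Bochner_Integration.integrable_bound) (auto simp: indicator_def)
  have "emeasure lborel {0<..h} < \<infinity>" by (cases "h \<ge> 0") auto
  then show "integrable lborel (\<lambda>s. indicator {0<..h} s * g0 x)"
    by (intro integrable_mult_left integrable_real_indicator) auto
qed

text \<open>The substitution \<open>y = x + s\<close> turns the moving window into the fixed window
  \<open>{0<..h}\<close>, which prepares the exchange of integrals below.\<close>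

lemma steklov_minus:
  assumes h: "h > 0"
  shows "steklov g0 h x - g0 x = (\<integral>s. indicator {0<..h} s * (g0 (x + s) - g0 x) \<partial>lborel) / h"
proof -
  have "(\<integral>s. indicator {0<..h} s * g0 (x + s) \<partial>lborel)
      = (\<integral>s. indicator {x<..x+h} (x + 1 * s) * g0 (x + 1 * s) \<partial>lborel)"
    by (intro Bochner_Integration.integral_cong) (auto simp: indicator_def)
  also have "\<dots> = (\<integral>y. indicator {x<..x+h} y * g0 y \<partial>lborel)"
    by (subst lborel_integral_real_affine[of 1 _ x]) auto
  also have "\<dots> = (\<integral>y. indicator {..x+h} y * g0 y - indicator {..x} y * g0 y \<partial>lborel)"
    using h by (intro Bochner_Integration.integral_cong) (auto simp: indicator_def)
  also have "\<dots> = steklov_primitive g0 (x + h) - steklov_primitive g0 x"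
    unfolding steklov_primitive_def by (intro Bochner_Integration.integral_diff integrable_indicator_g0)
  finally have 1: "(\<integral>s. indicator {0<..h} s * g0 (x + s) \<partial>lborel) = h * steklov g0 h x"
    using h by (simp add: steklov_def)
  have 2: "(\<integral>s. indicator {0<..h} s * g0 x \<partial>lborel) = h * g0 x"
    using h by simp
  have "(\<integral>s. indicator {0<..h} s * (g0 (x + s) - g0 x) \<partial>lborel)
      = (\<integral>s. indicator {0<..h} s * g0 (x + s) - indicator {0<..h} s * g0 x \<partial>lborel)"
    by (simp add: algebra_simps)
  also have "\<dots> = h * steklov g0 h x - h * g0 x"
    using Bochner_Integration.integral_diff[OF window_integrable] 1 2 by simp
  finally show ?thesis using h by (simp add: field_simps)
qed

text \<open>Minkowski's inequality in L1 by Fubini: after the exchange the inner integral is the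
  translation error of \<open>g0\<close> by \<open>s\<close>, at most \<open>e\<close> throughout
  the window. Multiplying by \<open>h\<close> keeps division out of the extended reals.\<close>

lemma halfline_L1_steklov_minus:
  assumes h: "h > 0"
    and small: "\<And>s. 0 < s \<Longrightarrow> s \<le> h \<Longrightarrow> halfline_L1 (\<lambda>x. g0 (x + s) - g0 x) \<le> ennreal e"
  shows "halfline_L1 (\<lambda>x. steklov g0 h x - g0 x) \<le> ennreal e"
proof -
  let ?K = "\<lambda>x s. indicator {0..} x * (indicator {0<..h} s * ennreal \<bar>g0 (x + s) - g0 x\<bar>)"
  have "ennreal h * halfline_L1 (\<lambda>x. steklov g0 h x - g0 x)
      = (\<integral>\<^sup>+x. ennreal h * (indicator {0..} x * ennreal \<bar>steklov g0 h x - g0 x\<bar>) \<partial>lborel)"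
    unfolding halfline_L1_def by (subst nn_integral_cmult) auto
  also have "\<dots> \<le> (\<integral>\<^sup>+x. (\<integral>\<^sup>+s. ?K x s \<partial>lborel) \<partial>lborel)"
  proof (rule nn_integral_mono)
    fix x :: real
    have "ennreal h * ennreal \<bar>steklov g0 h x - g0 x\<bar>
        = ennreal (norm (\<integral>s. indicator {0<..h} s * (g0 (x + s) - g0 x) \<partial>lborel))"
      using h by (simp add: steklov_minus flip: ennreal_mult)
    also have "\<dots> \<le> (\<integral>\<^sup>+s. norm (indicator {0<..h} s * (g0 (x + s) - g0 x)) \<partial>lborel)"
      by (rule integral_norm_bound_ennreal) (use Bochner_Integration.integrable_diff[OF window_integrable] in \<open>simp add: right_diff_distrib\<close>)
    also have "\<dots> = (\<integral>\<^sup>+s. indicator {0<..h} s * ennreal \<bar>g0 (x + s) - g0 x\<bar> \<partial>lborel)"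
      by (intro nn_integral_cong) (auto simp: indicator_def)
    finally have "indicator {0..} x * (ennreal h * ennreal \<bar>steklov g0 h x - g0 x\<bar>) \<le> indicator {0..} x * \<dots>"
      by (intro mult_left_mono) auto
    then show "ennreal h * (indicator {0..} x * ennreal \<bar>steklov g0 h x - g0 x\<bar>) \<le> (\<integral>\<^sup>+s. ?K x s \<partial>lborel)"
      by (subst nn_integral_cmult) (auto simp: ac_simps)
  qed
  also have "\<dots> = (\<integral>\<^sup>+s. (\<integral>\<^sup>+x. ?K x s \<partial>lborel) \<partial>lborel)"
    by (rule lborel_pair.Fubini') measurable
  also have "\<dots> = (\<integral>\<^sup>+s. indicator {0<..h} s * halfline_L1 (\<lambda>x. g0 (x + s) - g0 x) \<partial>lborel)"
    unfolding halfline_L1_def by (intro nn_integral_cong, subst nn_integral_cmult[symmetric])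
      (auto simp: ac_simps)
  also have "\<dots> \<le> (\<integral>\<^sup>+s. ennreal e * indicator {0<..h} s \<partial>lborel)"
    using small by (intro nn_integral_mono) (auto simp: indicator_def)
  also have "\<dots> = ennreal h * ennreal e"
    using h by (subst nn_integral_cmult_indicator) (auto simp: ac_simps)
  finally show ?thesis
    using h by (subst (asm) ennreal_mult_le_mult_iff) auto
qed

text \<open>
  The Steklov mean over a window of length \<open>h\<close> is exactly the arithmetic mean of \<open>n\<close> translates of
  the Steklov mean over a window of length \<open>h / n\<close>; the difference below is therefore an average of
  translates of \<open>steklov g0 (h / n) - g0\<close>.
\<close>

lemma steklov_minus_translation_mean:
  assumes "n > 0" "h > 0"
  shows "steklov g0 h x - translation_mean g0 h n x
     = (\<Sum>j<n. (steklov g0 (h / n) (x + real j * (h / n)) - g0 (x + real j * (h / n))) / n)"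
proof -
  let ?P = "\<lambda>j. steklov_primitive g0 (x + real j * (h / n))"
  \<comment> \<open>Windows of length \<open>h / n\<close> abut, and the weight \<open>1 / n\<close>
    turns division by \<open>h / n\<close> into division by \<open>h\<close>; the sum
    telescopes.\<close>
  have "(\<Sum>j<n. steklov g0 (h / n) (x + real j * (h / n)) / n) = (\<Sum>j<n. (?P (Suc j) - ?P j) / h)"
    using assms by (intro sum.cong) (auto simp: steklov_def divide_simps algebra_simps)
  also have "\<dots> = (?P n - ?P 0) / h"
    by (simp only: sum_divide_distrib[symmetric] sum_lessThan_telescope[of ?P])
  also have "\<dots> = steklov g0 h x" using assms by (simp add: steklov_def)
  finally show ?thesis
    by (simp add: translation_mean_def sum_subtractf diff_divide_distrib)
qed

lemma translation_mean_measurable [measurable]: "translation_mean g0 h n \<in> borel_measurable borel"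
  unfolding translation_mean_def by measurable

text \<open>The difference is an average of \<open>n\<close> forward translates of one function.
  None of them exceeds that function in \<open>halfline_L1\<close>, and the weights add up to
  one.\<close>

lemma halfline_L1_steklov_translation_mean:
  assumes "n > 0" "h > 0"
  shows "halfline_L1 (\<lambda>x. steklov g0 h x - translation_mean g0 h n x)
     \<le> halfline_L1 (\<lambda>x. steklov g0 (h / n) x - g0 x)"
proof -
  let ?D = "\<lambda>x. steklov g0 (h / n) x - g0 x"
  let ?a = "\<lambda>j. real j * (h / n)"
  have "halfline_L1 (\<lambda>x. steklov g0 h x - translation_mean g0 h n x)
      \<le> (\<integral>\<^sup>+x. (\<Sum>j<n. ennreal (1 / n) * (indicator {0..} x * ennreal \<bar>?D (x + ?a j)\<bar>)) \<partial>lborel)"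
    unfolding halfline_L1_def
  proof (rule nn_integral_mono)
    fix x :: real
    have "\<bar>steklov g0 h x - translation_mean g0 h n x\<bar> \<le> (\<Sum>j<n. (1 / n) * \<bar>?D (x + ?a j)\<bar>)"
      unfolding steklov_minus_translation_mean[OF assms]
      by (rule order_trans[OF sum_abs]) (simp add: abs_divide)
    then have "ennreal \<bar>steklov g0 h x - translation_mean g0 h n x\<bar>
        \<le> ennreal (\<Sum>j<n. (1 / n) * \<bar>?D (x + ?a j)\<bar>)"
      by (rule ennreal_leI)
    also have "\<dots> = (\<Sum>j<n. ennreal (1 / n) * ennreal \<bar>?D (x + ?a j)\<bar>)"
      by (subst sum_ennreal[symmetric]) (auto simp: ennreal_mult[symmetric])
    finally show "indicator {0..} x * ennreal \<bar>steklov g0 h x - translation_mean g0 h n x\<bar>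
        \<le> (\<Sum>j<n. ennreal (1 / n) * (indicator {0..} x * ennreal \<bar>?D (x + ?a j)\<bar>))"
      by (auto simp: indicator_def)
  qed
  also have "\<dots> = (\<Sum>j<n. ennreal (1 / n) * halfline_L1 (\<lambda>x. ?D (x + ?a j)))"
    unfolding halfline_L1_def by (subst nn_integral_sum) (auto simp: nn_integral_cmult)
  also have "\<dots> \<le> (\<Sum>j<n. ennreal (1 / n) * halfline_L1 ?D)"
    using assms by (intro sum_mono mult_left_mono halfline_L1_translate) auto
  also have "\<dots> = halfline_L1 ?D"
    using assms by (simp add: ennreal_of_nat_eq_real_of_nat mult.assoc[symmetric] flip: ennreal_mult)
  finally show ?thesis .
qed

end

section \<open>Continuous functions when 1 has absolutely continuous norm, and their density\<close>

locale ac_banach_function_norm = banach_function_norm +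
  assumes one_ac: "(\<lambda>x. 1) \<in> bfs_ac \<rho>"
begin

lemma N_1_finite: "N (\<lambda>x. 1) < \<infinity>"
  using one_ac by (simp add: bfs_ac_def bfs_def)

definition norm1 :: real where "norm1 = enn2real (N (\<lambda>x. 1))"

lemma norm1: "N (\<lambda>x. 1) = ennreal norm1" "norm1 \<ge> 0"
  using N_1_finite by (auto simp: norm1_def)

lemma N_le_bound:
  assumes "f \<in> borel_measurable unit_measure" "AE x in unit_measure. \<bar>f x\<bar> \<le> M" "M \<ge> 0"
  shows "N f \<le> ennreal (M * norm1)"
proof -
  have "N f \<le> N (\<lambda>x. M * 1)"
    using assms by (intro N_mono) auto
  also have "\<dots> = ennreal (M * norm1)"
    using assms norm1 by (subst N_scale) (auto simp: ennreal_mult)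
  finally show ?thesis .
qed

lemma continuous_in_X:
  assumes "continuous_on {0..1} (g :: real \<Rightarrow> real)"
  shows "g \<in> X"
proof -
  have "compact (g ` {0..1})" using assms by (rule compact_continuous_image) simp
  then obtain M where M: "\<And>x. x \<in> {0..1} \<Longrightarrow> \<bar>g x\<bar> \<le> M"
    using compact_imp_bounded bounded_iff by (metis imageI real_norm_def)
  have "M \<ge> 0" using M[of 0] by auto
  have "N g \<le> ennreal (M * norm1)"
    by (rule N_le_bound[OF continuous_on_borel_measurable_unit_measure[OF assms] _ \<open>M \<ge> 0\<close>])
       (use M in \<open>auto intro!: AE_I2\<close>)
  also have "\<dots> < \<infinity>" by simp
  finally show ?thesis
    using continuous_on_borel_measurable_unit_measure[OF assms] by (simp add: bfs_def)
qed

text \<open>Here the absolute continuity of the norm of 1 enters. The intervals are those on which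
  the translate by \<open>\<delta>\<close> is cut off.\<close>

lemma N_right_end_tendsto_0: "((\<lambda>\<delta>. N (indicator {1-\<delta><..1})) \<longlongrightarrow> 0) (at_right 0)"
proof (rule tendsto_at_right_sequentially[OF zero_less_one])
  fix S :: "nat \<Rightarrow> real"
  assume S: "S \<longlonglongrightarrow> 0" "\<And>n. 0 < S n" "\<And>n. S n < 1"
  \<comment> \<open>The endpoint 1 lies in every one of the intervals and is excluded as a null
    set.\<close>
  have "AE x in unit_measure. (\<lambda>n. indicator {1 - S n<..1} x :: real) \<longlonglongrightarrow> 0"
    unfolding AE_unit_measure_iff using AE_lborel_singleton[of "1::real"]
  proof eventually_elim
    case (elim x)
    show ?case
    proof
      assume "x \<in> {0..1}"
      with elim have "0 < 1 - x" by auto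
      from order_tendstoD(2)[OF S(1) this]
      have "eventually (\<lambda>n. 0 = (indicator {1 - S n<..1} x :: real)) sequentially"
        by eventually_elim auto
      then show "(\<lambda>n. indicator {1 - S n<..1} x :: real) \<longlonglongrightarrow> 0"
        by (rule tendsto_eventually[OF eventually_mono]) auto
    qed
  qed
  moreover have "{1 - S n<..1} \<in> sets unit_measure" for n
    unfolding unit_measure_def using S(3)[of n] by (subst sets_restrict_space_iff) auto
  ultimately have "(\<lambda>n. N (\<lambda>x. 1 * indicator {1 - S n<..1} x)) \<longlonglongrightarrow> 0"
    using one_ac[unfolded bfs_ac_def, THEN CollectD, THEN conjunct2,
        THEN spec[of _ "\<lambda>n. {1 - S n<..1}"]] by simp
  then show "(\<lambda>n. N (indicator {1 - S n<..1})) \<longlonglongrightarrow> 0" by simp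
qed

text \<open>Where \<open>x + \<delta>\<close> stays in the interval, uniform continuity makes the
  difference small. On the cut-off end it is bounded by \<open>M\<close>, and the norm of that end
  tends to 0.\<close>

lemma continuous_in_S0:
  assumes g: "continuous_on {0..1} (g :: real \<Rightarrow> real)"
  shows "g \<in> S0"
proof -
  have gm [measurable]: "g \<in> borel_measurable unit_measure"
    by (rule continuous_on_borel_measurable_unit_measure[OF g])
  have "compact (g ` {0..1})" using g by (rule compact_continuous_image) simp
  then obtain M where M: "\<And>x. x \<in> {0..1} \<Longrightarrow> \<bar>g x\<bar> \<le> M"
    using compact_imp_bounded bounded_iff by (metis imageI real_norm_def)
  have "M \<ge> 0" using M[of 0] by auto
  have uc: "uniformly_continuous_on {0..1} g"
    using g by (rule compact_uniformly_continuous) simp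
  have "((\<lambda>\<delta>. N (\<lambda>x. shift \<delta> g x - g x)) \<longlongrightarrow> 0) (at_right 0)"
  proof (rule ennreal_tendsto_0I)
    fix e :: real assume e: "e > 0"
    \<comment> \<open>Each of the two regions gets half of \<open>e\<close>; the added 1 covers
      \<open>norm1 = 0\<close> and \<open>M = 0\<close>.\<close>
    define e1 where "e1 = e / (2 * (norm1 + 1))"
    define e2 where "e2 = e / (2 * (M + 1))"
    have e1: "e1 > 0" "e1 * norm1 \<le> e/2"
      using e norm1(2) by (auto simp: e1_def field_simps)
    have e2: "e2 > 0" "M * e2 \<le> e/2"
      using e \<open>M \<ge> 0\<close> by (auto simp: e2_def field_simps)
    obtain d where d: "d > 0" "\<And>x y. x \<in> {0..1} \<Longrightarrow> y \<in> {0..1} \<Longrightarrow> \<bar>x - y\<bar> < d \<Longrightarrow> \<bar>g x - g y\<bar> < e1"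
      using uc e1(1) unfolding uniformly_continuous_on_def dist_real_def by metis
    have "eventually (\<lambda>\<delta>::real. \<delta> \<in> {0<..<d}) (at_right 0)"
      using d(1) by (rule eventually_at_rightI[rotated]) auto
    then show "eventually (\<lambda>\<delta>. N (\<lambda>x. shift \<delta> g x - g x) \<le> ennreal e) (at_right 0)"
      using ennreal_tendsto_0D[OF N_right_end_tendsto_0 e2(1)]
    proof eventually_elim
      case (elim \<delta>)
      have [measurable]: "(indicator {1-\<delta><..1} :: real \<Rightarrow> real) \<in> borel_measurable unit_measure"
        by (rule borel_measurable_unit_measureI) measurable
      have "N (\<lambda>x. shift \<delta> g x - g x) \<le> N (\<lambda>x. e1 * 1 + M * indicator {1-\<delta><..1} x)"
      proof (rule N_mono)
        show "AE x in unit_measure. \<bar>shift \<delta> g x - g x\<bar> \<le> \<bar>e1 * 1 + M * indicator {1-\<delta><..1} x\<bar>"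
        proof (rule AE_I2)
          fix x assume x: "x \<in> space unit_measure"
          show "\<bar>shift \<delta> g x - g x\<bar> \<le> \<bar>e1 * 1 + M * indicator {1-\<delta><..1} x\<bar>"
          proof (cases "x + \<delta> \<le> 1")
            case True
            then show ?thesis using d(2)[of "x + \<delta>" x] elim(1) x \<open>M \<ge> 0\<close> e1
              by (auto simp: shift_def indicator_def)
          next
            case False
            then show ?thesis using M[of x] x \<open>M \<ge> 0\<close> e1 by (auto simp: shift_def)
          qed
        qed
      qed auto
      also have "\<dots> \<le> N (\<lambda>x. e1 * 1) + N (\<lambda>x. M * indicator {1-\<delta><..1} x)"
        by (rule N_add) auto
      also have "\<dots> = ennreal (e1 * norm1) + ennreal M * N (indicator {1-\<delta><..1})"
        using e1 \<open>M \<ge> 0\<close> norm1 by (subst (1 2) N_scale) (auto simp: ennreal_mult)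
      also have "\<dots> \<le> ennreal (e/2) + ennreal M * ennreal e2"
        using e1 elim by (intro add_mono mult_left_mono ennreal_leI) auto
      also have "\<dots> \<le> ennreal (e/2) + ennreal (e/2)"
        using e2 \<open>M \<ge> 0\<close> by (intro add_mono) (auto simp flip: ennreal_mult intro!: ennreal_leI)
      also have "\<dots> = ennreal e" using e by (simp flip: ennreal_plus)
      finally show ?case .
    qed
  qed
  then show ?thesis using continuous_in_X[OF g] by (simp add: S0_def)
qed

lemma continuous_in_XS: "continuous_on {0..1} g \<Longrightarrow> g \<in> XS"
  by (intro S0_subset_XS continuous_in_S0)

text \<open>
  Minkowski's integral inequality for \<open>\<rho>\<close> is circumvented: the Riemann sums of the Steklov mean are
  convex combinations of translates and converge to it in \<open>L\<^sup>1\<close>, so Fatou's property suffices.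
\<close>

lemma S0_approx_continuous:
  assumes g: "g \<in> S0" and e: "e > 0"
  shows "\<exists>\<phi>. continuous_on {0..1} \<phi> \<and> N (\<lambda>x. g x - \<phi> x) \<le> ennreal e"
proof -
  have gm [measurable]: "g \<in> borel_measurable unit_measure"
    using g X_measurable S0_subset_X by auto
  \<comment> \<open>Extended by zero, \<open>g0 (x + s)\<close> equals \<open>shift s g x\<close>
    for all \<open>x\<close> and \<open>s\<close>: the cut-off translate becomes a true translate on
    the line.\<close>
  define g0 where "g0 x = indicator {0..1} x * g x" for x :: real
  have g0m [measurable]: "g0 \<in> borel_measurable borel"
    unfolding g0_def using gm borel_measurable_unit_measure_iff by blast
  have g0_on: "g0 x = g x" if "x \<in> {0..1}" for x using that by (simp add: g0_def)
  have g0_shift: "g0 (x + s) = shift s g x" for x s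
    by (auto simp: g0_def shift_def)
  obtain C where C: "C > 0" "\<And>f. f \<in> borel_measurable unit_measure \<Longrightarrow>
       (\<integral>\<^sup>+x. ennreal \<bar>f x\<bar> \<partial>unit_measure) \<le> ennreal C * N f"
    using N_L1 by blast
  have g0i: "integrable lborel g0"
  proof (rule integrableI_bounded)
    have "(\<integral>\<^sup>+x. ennreal (norm (g0 x)) \<partial>lborel) = (\<integral>\<^sup>+x. ennreal \<bar>g0 x\<bar> \<partial>unit_measure)"
      by (subst nn_integral_unit_measure, measurable, intro nn_integral_cong)
         (auto simp: g0_def indicator_def)
    also have "\<dots> = (\<integral>\<^sup>+x. ennreal \<bar>g x\<bar> \<partial>unit_measure)"
      by (intro nn_integral_cong) (auto simp: g0_on)
    also have "\<dots> \<le> ennreal C * N g" by (rule C(2)) fact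
    also have "\<dots> < \<infinity>" using X_finite[OF S0_subset_X[OF g]] by (auto intro: ennreal_mult_less_top[THEN iffD2])
    finally show "(\<integral>\<^sup>+x. ennreal (norm (g0 x)) \<partial>lborel) < \<infinity>" .
  qed simp
  then interpret steklov_mean g0 by unfold_locales
  \<comment> \<open>For \<open>x > 1\<close> both terms vanish because \<open>s > 0\<close>, so the
    integral reduces to the unit interval, where the L1 embedding bounds it by the norm.\<close>
  have half: "halfline_L1 (\<lambda>x. g0 (x + s) - g0 x) \<le> ennreal C * N (\<lambda>x. shift s g x - g x)" if "s > 0" for s
  proof -
    have "halfline_L1 (\<lambda>x. g0 (x + s) - g0 x) = (\<integral>\<^sup>+x. ennreal \<bar>g0 (x + s) - g0 x\<bar> \<partial>unit_measure)"
      unfolding halfline_L1_def using that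
      by (subst nn_integral_unit_measure, measurable, intro nn_integral_cong)
         (auto simp: g0_def indicator_def)
    also have "\<dots> = (\<integral>\<^sup>+x. ennreal \<bar>shift s g x - g x\<bar> \<partial>unit_measure)"
      by (intro nn_integral_cong) (auto simp: g0_on g0_shift)
    also have "\<dots> \<le> ennreal C * N (\<lambda>x. shift s g x - g x)"
      by (rule C(2)) measurable
    finally show ?thesis .
  qed
  have ev: "\<exists>d>0. \<forall>s. 0 < s \<longrightarrow> s < d \<longrightarrow> N (\<lambda>x. shift s g x - g x) \<le> ennreal r" if "r > 0" for r
    using ennreal_tendsto_0D[OF S0_tendsto[OF g] that] unfolding eventually_at_right_field by auto
  have ev_L1: "\<exists>d>0. \<forall>h. 0 < h \<longrightarrow> h < d \<longrightarrow> halfline_L1 (\<lambda>x. steklov g0 h x - g0 x) \<le> ennreal r" if "r > 0" for r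
  proof -
    from ev[of "r / C"] that C(1) obtain d where d: "d > 0"
      "\<And>s. 0 < s \<Longrightarrow> s < d \<Longrightarrow> N (\<lambda>x. shift s g x - g x) \<le> ennreal (r / C)" by auto
    have "halfline_L1 (\<lambda>x. steklov g0 h x - g0 x) \<le> ennreal r" if h: "0 < h" "h < d" for h
    proof (rule halfline_L1_steklov_minus[OF h(1)])
      fix s assume s: "0 < s" "s \<le> h"
      have "halfline_L1 (\<lambda>x. g0 (x + s) - g0 x) \<le> ennreal C * ennreal (r / C)"
        using half[OF s(1)] d(2)[of s] s h by (meson le_less_trans mult_left_mono order_trans zero_le)
      also have "\<dots> = ennreal r" using C(1) \<open>r > 0\<close> by (simp flip: ennreal_mult)
      finally show "halfline_L1 (\<lambda>x. g0 (x + s) - g0 x) \<le> ennreal r" .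
    qed
    with d(1) show ?thesis by blast
  qed
  obtain d1 where d1: "d1 > 0" "\<And>s. 0 < s \<Longrightarrow> s < d1 \<Longrightarrow> N (\<lambda>x. shift s g x - g x) \<le> ennreal e"
    using ev[OF e] by blast
  obtain d2 where d2: "d2 > 0" "\<And>h. 0 < h \<Longrightarrow> h < d2 \<Longrightarrow> halfline_L1 (\<lambda>x. steklov g0 h x - g0 x) \<le> ennreal 1"
    using ev_L1[of 1] by auto
  \<comment> \<open>\<open>d1\<close> makes every translate by less than \<open>h\<close> an
    \<open>e\<close>-approximation of \<open>g\<close> in norm; \<open>d2\<close>, with the
    arbitrary bound 1, makes the errors \<open>u n\<close> integrable.\<close>
  define h where "h = min d1 d2 / 2"
  have h: "h > 0" "h < d1" "h < d2" using d1(1) d2(1) by (auto simp: h_def)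
  \<comment> \<open>\<open>Suc n\<close> keeps the number of nodes positive.\<close>
  define S where "S n = translation_mean g0 h (Suc n)" for n
  define u where "u n x = steklov g0 h x - S n x" for n x
  have [measurable]: "u n \<in> borel_measurable borel" "S n \<in> borel_measurable borel" for n
    unfolding u_def S_def by measurable
  have um [measurable]: "u n \<in> borel_measurable unit_measure" "S n \<in> borel_measurable unit_measure"
    "steklov g0 h \<in> borel_measurable unit_measure" for n
    by (rule borel_measurable_unit_measureI, measurable)+
  have u_le: "(\<integral>\<^sup>+x. ennreal \<bar>u n x\<bar> \<partial>unit_measure) \<le> halfline_L1 (\<lambda>x. steklov g0 (h / Suc n) x - g0 x)" for n
  proof -
    have "(\<integral>\<^sup>+x. ennreal \<bar>u n x\<bar> \<partial>unit_measure) \<le> halfline_L1 (u n)"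
      unfolding halfline_L1_def
      by (subst nn_integral_unit_measure) (auto simp: indicator_def intro!: nn_integral_mono)
    also have "\<dots> \<le> halfline_L1 (\<lambda>x. steklov g0 (h / Suc n) x - g0 x)"
      unfolding u_def S_def by (rule halfline_L1_steklov_translation_mean) (use h in auto)
    finally show ?thesis .
  qed
  have h_small: "0 < h / real (Suc n)" "h / real (Suc n) \<le> h" for n
    using h by (auto simp: field_simps)
  have u_int: "integrable unit_measure (u n)" for n
  proof (rule integrableI_bounded)
    have "(\<integral>\<^sup>+x. ennreal (norm (u n x)) \<partial>unit_measure) \<le> ennreal 1"
      using u_le[of n] d2(2)[of "h / real (Suc n)"] h_small[of n] h by (auto intro: order_trans)
    then show "(\<integral>\<^sup>+x. ennreal (norm (u n x)) \<partial>unit_measure) < \<infinity>"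
      by (rule le_less_trans) simp
  qed simp
  have "(\<lambda>n. \<integral>\<^sup>+x. ennreal \<bar>u n x\<bar> \<partial>unit_measure) \<longlonglongrightarrow> 0"
  proof (rule ennreal_tendsto_0I)
    fix r :: real assume "r > 0"
    from ev_L1[OF this] obtain d where d: "d > 0"
      "\<And>h. 0 < h \<Longrightarrow> h < d \<Longrightarrow> halfline_L1 (\<lambda>x. steklov g0 h x - g0 x) \<le> ennreal r" by auto
    have "(\<lambda>n. h / real (Suc n)) \<longlonglongrightarrow> 0"
      by (rule LIMSEQ_Suc[OF lim_const_over_n])
    from order_tendstoD(2)[OF this d(1)]
    show "eventually (\<lambda>n. (\<integral>\<^sup>+x. ennreal \<bar>u n x\<bar> \<partial>unit_measure) \<le> ennreal r) sequentially"
      by eventually_elim (use u_le d(2) h_small in \<open>blast intro: order_trans\<close>)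
  qed
  then have "(\<lambda>n. enn2real (\<integral>\<^sup>+x. ennreal \<bar>u n x\<bar> \<partial>unit_measure)) \<longlonglongrightarrow> enn2real 0"
    by (intro tendsto_enn2real) auto
  then have "(\<lambda>n. \<integral>x. norm (u n x) \<partial>unit_measure) \<longlonglongrightarrow> 0"
    by (simp add: integral_eq_nn_integral)
  \<comment> \<open>L1 convergence gives a.e. convergence along a subsequence, which is all that
    \<open>N_Fatou\<close> asks for.\<close>
  from tendsto_L1_AE_subseq[OF u_int this] obtain r where
    r: "AE x in unit_measure. (\<lambda>n. u (r n) x) \<longlonglongrightarrow> 0" by blast
  have "N (\<lambda>x. g x - steklov g0 h x) \<le> ennreal e"
  proof (rule N_Fatou[where u = "\<lambda>k x. g x - S (r k) x"])
    show "AE x in unit_measure. (\<lambda>k. g x - S (r k) x) \<longlonglongrightarrow> g x - steklov g0 h x"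
      using r
    proof eventually_elim
      case (elim x)
      have "(\<lambda>n. (g x - steklov g0 h x) + u (r n) x) \<longlonglongrightarrow> (g x - steklov g0 h x) + 0"
        by (intro tendsto_add tendsto_const elim)
      then show ?case by (simp add: u_def)
    qed
    fix k
    define n where "n = Suc (r k)"
    let ?a = "\<lambda>j. real j * (h / real n)"
    have n: "n > 0" by (simp add: n_def)
    have "N (\<lambda>x. g x - S (r k) x) = N (\<lambda>x. S (r k) x - g x)" by (rule N_minus_commute)
    \<comment> \<open>The weights add up to one, so \<open>g\<close> can be distributed over the sum
      and each summand becomes a translation error.\<close>
    also have "\<dots> = N (\<lambda>x. \<Sum>j<n. (1 / n) * (shift (?a j) g x - g x))"
    proof (rule arg_cong[where f = N], rule ext)
      fix x
      have "S (r k) x - g x = (\<Sum>j<n. shift (?a j) g x / n) - (\<Sum>j<n. g x / n)"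
        using n by (simp add: S_def translation_mean_def g0_shift flip: n_def)
      then show "S (r k) x - g x = (\<Sum>j<n. (1 / n) * (shift (?a j) g x - g x))"
        by (simp add: sum_subtractf diff_divide_distrib)
    qed
    also have "\<dots> \<le> (\<Sum>j<n. N (\<lambda>x. (1 / n) * (shift (?a j) g x - g x)))"
      by (rule N_sum) auto
    also have "\<dots> \<le> (\<Sum>j<n. ennreal (1 / n) * ennreal e)"
    proof (rule sum_mono)
      fix j assume j: "j \<in> {..<n}"
      have "N (\<lambda>x. shift (?a j) g x - g x) \<le> ennreal e"
      \<comment> \<open>\<open>d1\<close> speaks of positive translations only; for
        \<open>j = 0\<close> the error vanishes on the interval.\<close>
      proof (cases "j = 0")
        case True
        have "N (\<lambda>x. shift (?a j) g x - g x) = N (\<lambda>x. 0)"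
          by (rule N_cong, measurable) (use True in \<open>auto simp: shift_def intro!: AE_I2\<close>)
        then show ?thesis by (simp add: N_0)
      next
        case False
        have "?a j < h" using j h n by (auto simp: field_simps)
        then show ?thesis using d1(2)[of "?a j"] False h n by auto
      qed
      then have "ennreal (1 / n) * N (\<lambda>x. shift (?a j) g x - g x) \<le> ennreal (1 / n) * ennreal e"
        by (rule mult_left_mono) simp
      then show "N (\<lambda>x. (1 / n) * (shift (?a j) g x - g x)) \<le> ennreal (1 / n) * ennreal e"
        by (subst N_scale) auto
    qed
    also have "\<dots> = ennreal e"
      using n by (simp add: ennreal_of_nat_eq_real_of_nat mult.assoc[symmetric] flip: ennreal_mult)
    finally show "N (\<lambda>x. g x - S (r k) x) \<le> ennreal e" .
  qed auto
  moreover have "continuous_on {0..1} (steklov g0 h)"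
    by (rule continuous_steklov)
  ultimately show ?thesis by blast
qed

lemma XS_approx_continuous:
  assumes f: "f \<in> XS" and e: "e > 0"
  shows "\<exists>\<phi>. continuous_on {0..1} \<phi> \<and> N (\<lambda>x. f x - \<phi> x) \<le> ennreal e"
proof -
  obtain g where g: "g \<in> S0" "N (\<lambda>x. f x - g x) < ennreal (e/2)"
    using XS_approx[OF f, of "e/2"] e by auto
  obtain \<phi> where \<phi>: "continuous_on {0..1} \<phi>" "N (\<lambda>x. g x - \<phi> x) \<le> ennreal (e/2)"
    using S0_approx_continuous[OF g(1), of "e/2"] e by auto
  have "N (\<lambda>x. f x - \<phi> x) \<le> N (\<lambda>x. f x - g x) + N (\<lambda>x. g x - \<phi> x)"
    using XS_measurable[OF f] X_measurable[OF S0_subset_X[OF g(1)]]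
      continuous_on_borel_measurable_unit_measure[OF \<phi>(1)] by (rule N_triangle)
  also have "\<dots> \<le> ennreal (e/2) + ennreal (e/2)"
    using g \<phi> by (intro add_mono) auto
  also have "\<dots> = ennreal e" using e by (simp flip: ennreal_plus)
  finally show ?thesis using \<phi>(1) by blast
qed

end

subsection \<open>Positive operators and Korovkin's argument\<close>

text \<open>Serves to pass from countably many parameters \<open>u\<close>, which share one null
  set, to all of them.\<close>

lemma nonneg_if_nonneg_on_Rats:
  fixes G :: "real \<Rightarrow> real"
  assumes "continuous_on {0..1} G" "\<And>u. u \<in> \<rat> \<Longrightarrow> u \<in> {0..1} \<Longrightarrow> 0 \<le> G u" "u \<in> {0..1}"
  shows "0 \<le> G u"
proof (rule ccontr)
  assume "\<not> 0 \<le> G u"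
  then obtain d where d: "d > 0" "\<And>v. v \<in> {0..1} \<Longrightarrow> \<bar>v - u\<bar> < d \<Longrightarrow> \<bar>G v - G u\<bar> < - G u"
    using assms(1,3) unfolding continuous_on_iff dist_real_def
    by (metis linorder_not_le neg_0_less_iff_less)
  \<comment> \<open>Clipped to the unit interval, the neighbourhood keeps positive length even if
    \<open>u\<close> is an endpoint.\<close>
  have "max 0 (u - d) < min 1 (u + d)" using d(1) assms(3) by auto
  then obtain r where r: "r \<in> \<rat>" "max 0 (u - d) < r" "r < min 1 (u + d)"
    using Rats_dense_in_real by blast
  then have "\<bar>r - u\<bar> < d" "r \<in> {0..1}" by auto
  with d(2)[of r] assms(2)[of r] r(1) show False by auto
qed

text \<open>Points closer than \<open>d\<close> are handled by uniform continuity. Otherwise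
  \<open>(s - u)\<^sup>2 / d\<^sup>2\<close> is at least 1, and \<open>2 * M\<close> bounds the
  difference; hence \<open>C = 2 * M / d\<^sup>2\<close>.\<close>

lemma continuous_quadratic_modulus:
  assumes f: "continuous_on {0..1} (f :: real \<Rightarrow> real)" and e: "e > 0"
  shows "\<exists>C\<ge>0. \<forall>s\<in>{0..1}. \<forall>u\<in>{0..1}. \<bar>f s - f u\<bar> \<le> e + C * (s - u)\<^sup>2"
proof -
  have "compact (f ` {0..1})" using f by (rule compact_continuous_image) simp
  then obtain M where M: "\<And>x. x \<in> {0..1} \<Longrightarrow> \<bar>f x\<bar> \<le> M"
    using compact_imp_bounded bounded_iff by (metis imageI real_norm_def)
  have "M \<ge> 0" using M[of 0] by auto
  have "uniformly_continuous_on {0..1} f"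
    using f by (rule compact_uniformly_continuous) simp
  then obtain d where d: "d > 0" "\<And>x y. x \<in> {0..1} \<Longrightarrow> y \<in> {0..1} \<Longrightarrow> \<bar>x - y\<bar> < d \<Longrightarrow> \<bar>f x - f y\<bar> < e"
    using e unfolding uniformly_continuous_on_def dist_real_def by metis
  have "\<bar>f s - f u\<bar> \<le> e + 2 * M / d\<^sup>2 * (s - u)\<^sup>2" if su: "s \<in> {0..1}" "u \<in> {0..1}" for s u
  proof (cases "\<bar>s - u\<bar> < d")
    case True
    have "0 \<le> 2 * M / d\<^sup>2 * (s - u)\<^sup>2" using \<open>M \<ge> 0\<close> by simp
    with d(2)[OF su True] show ?thesis by linarith
  next
    case False
    then have "d\<^sup>2 \<le> (s - u)\<^sup>2" using d(1) abs_le_square_iff[of d "s - u"] by auto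
    then have "2 * M * 1 \<le> 2 * M * ((s - u)\<^sup>2 / d\<^sup>2)"
      using \<open>M \<ge> 0\<close> d(1) by (intro mult_left_mono) auto
    with M[OF su(1)] M[OF su(2)] e show ?thesis by auto
  qed
  then show ?thesis using \<open>M \<ge> 0\<close> by (intro exI[of _ "2 * M / d\<^sup>2"]) auto
qed

lemma in_C01_cont_version:
  assumes "in_C01 f"
  shows "continuous_on {0..1} (cont_version f)" "AE x in unit_measure. f x = cont_version f x"
  using someI_ex[OF assms[unfolded in_C01_def]] unfolding cont_version_def by auto

lemma C01_norm_upper:
  assumes "continuous_on {0..1} h" "t \<in> {0..1}"
  shows "\<bar>h t\<bar> \<le> C01_norm h"
proof -
  have "compact ((\<lambda>t. \<bar>h t\<bar>) ` {0..1})"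
    using assms(1) by (intro compact_continuous_image continuous_intros) auto
  then have "bdd_above ((\<lambda>t. \<bar>h t\<bar>) ` {0..1})"
    by (intro bounded_imp_bdd_above compact_imp_bounded)
  then show ?thesis unfolding C01_norm_def using assms(2) by (intro cSUP_upper)
qed

text \<open>The continuous versions agree a.e. with the functions themselves, so the sup-norm error
  passes to the latter as an a.e. bound.\<close>

lemma converges_in_C01_AE:
  assumes "converges_in_C01 F f"
  obtains d :: "nat \<Rightarrow> real" where "d \<longlonglongrightarrow> 0" "\<And>n. AE x in unit_measure. \<bar>F n x - f x\<bar> \<le> d n"
proof (rule that)
  let ?d = "\<lambda>n. C01_norm (\<lambda>t. cont_version (F n) t - cont_version f t)"
  show "?d \<longlonglongrightarrow> 0" using assms by (simp add: converges_in_C01_def)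
  fix n
  have F: "in_C01 (F n)" "in_C01 f" using assms by (auto simp: converges_in_C01_def)
  show "AE x in unit_measure. \<bar>F n x - f x\<bar> \<le> ?d n"
    using in_C01_cont_version(2)[OF F(1)] in_C01_cont_version(2)[OF F(2)] AE_space
  proof eventually_elim
    case (elim x)
    then show ?case
      using C01_norm_upper[of "\<lambda>t. cont_version (F n) t - cont_version f t" x]
        in_C01_cont_version(1)[OF F(1)] in_C01_cont_version(1)[OF F(2)]
      by (auto intro: continuous_on_diff)
  qed
qed

text \<open>
  With \<open>u = a1 / a0\<close> the degeneracy \<open>a0 * a2 = a1\<^sup>2\<close> says that the limit functional annihilates
  \<open>(t - u)\<^sup>2\<close>, as a point evaluation at \<open>u\<close> would.
\<close>

lemma korovkin_pointwise:
  fixes a0 a1 a2 p q r :: real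
  assumes a0: "a0 > 0" and deg: "a0 * a2 = a1\<^sup>2" and a1: "0 \<le> a1" "a1 \<le> a0"
    and near: "\<bar>p - a0\<bar> \<le> d" "\<bar>q - a1\<bar> \<le> d" "\<bar>r - a2\<bar> \<le> d"
    and u: "u = a1 / a0"
    and y: "\<bar>y - v * p\<bar> \<le> e * p + C * (r - 2 * u * q + u\<^sup>2 * p)"
    and z: "\<bar>z - v * a0\<bar> \<le> e * a0 + C * (a2 - 2 * u * a1 + u\<^sup>2 * a0)"
    and bounds: "\<bar>v\<bar> \<le> F" "a0 \<le> M" "e \<ge> 0" "C \<ge> 0"
  shows "\<bar>y - z\<bar> \<le> F * d + e * (2 * M + d) + 4 * C * d"
proof -
  have u01: "0 \<le> u" "u \<le> 1" using a0 a1 u by auto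
  have a1u: "a1 = u * a0" using u a0 by simp
  have "a0 * a2 = a0 * (u\<^sup>2 * a0)" unfolding deg a1u by (simp add: power2_eq_square)
  then have a2u: "a2 = u\<^sup>2 * a0" using a0 by simp
  have zero: "a2 - 2 * u * a1 + u\<^sup>2 * a0 = 0"
    unfolding a1u a2u by (simp add: power2_eq_square)
  have "u * \<bar>q - a1\<bar> \<le> 1 * d" using u01 near by (intro mult_mono) auto
  then have q: "\<bar>u * (q - a1)\<bar> \<le> d" using u01 by (simp add: abs_mult)
  have "u\<^sup>2 \<le> 1" using u01 by (simp add: power_le_one)
  then have "u\<^sup>2 * \<bar>p - a0\<bar> \<le> 1 * d" using near by (intro mult_mono) auto
  then have p: "\<bar>u\<^sup>2 * (p - a0)\<bar> \<le> d" by (simp add: abs_mult)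
  \<comment> \<open>The quadratic term is zero at the limit values, so only deviations remain;
    \<open>4 * d\<close> collects the coefficients 1, 2 and 1, using \<open>0 \<le> u\<close> and
    \<open>u \<le> 1\<close>.\<close>
  have "r - 2 * u * q + u\<^sup>2 * p = (r - a2) - 2 * (u * (q - a1)) + u\<^sup>2 * (p - a0)"
    using zero by (simp add: algebra_simps)
  also have "\<dots> \<le> 4 * d" using q p near by linarith
  finally have "C * (r - 2 * u * q + u\<^sup>2 * p) \<le> C * (4 * d)"
    using bounds by (intro mult_left_mono)
  moreover have "e * p \<le> e * (M + d)" using near bounds by (intro mult_left_mono) auto
  moreover have "e * a0 \<le> e * M" using bounds by (intro mult_left_mono)
  moreover have "\<bar>v\<bar> * \<bar>p - a0\<bar> \<le> F * d" using near bounds by (intro mult_mono) auto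
  then have "\<bar>v * p - v * a0\<bar> \<le> F * d" by (simp add: abs_mult flip: right_diff_distrib)
  moreover have "\<bar>y - z\<bar> \<le> \<bar>y - v * p\<bar> + \<bar>v * p - v * a0\<bar> + \<bar>z - v * a0\<bar>" by linarith
  ultimately show ?thesis using y z unfolding zero by (simp add: algebra_simps)
qed

section \<open>Series of non-negative functions in \<open>XS\<close>\<close>

context banach_function_norm
begin

text \<open>A Riesz-Fischer argument: the L1 embedding gives summability a.e., Fatou's property
  bounds the tails, and \<open>XS_closed\<close> puts the sum into \<open>XS\<close>.\<close>

lemma XS_monotone_series:
  assumes f: "\<And>k. f k \<in> XS" and nonneg: "\<And>k x. 0 \<le> f k x"
    and le: "\<And>k. N (f k) \<le> ennreal ((1/2) ^ k)"
  obtains g where "g \<in> XS" "\<And>k. AE x in unit_measure. f k x \<le> g x"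
proof -
  have fm [measurable]: "f k \<in> borel_measurable unit_measure" for k
    using f XS_measurable by blast
  obtain C where C: "C > 0" "\<And>f. f \<in> borel_measurable unit_measure \<Longrightarrow>
       (\<integral>\<^sup>+x. ennreal \<bar>f x\<bar> \<partial>unit_measure) \<le> ennreal C * N f"
    using N_L1 by blast
  have geo: "(\<Sum>k. ennreal ((1/2) ^ k)) = ennreal 2"
  proof (rule suminf_ennreal_eq)
    show "(\<lambda>k. (1/2::real) ^ k) sums 2" using geometric_sums[of "1/2 :: real"] by simp
  qed simp
  have "(\<integral>\<^sup>+x. (\<Sum>k. ennreal (f k x)) \<partial>unit_measure) = (\<Sum>k. \<integral>\<^sup>+x. ennreal (f k x) \<partial>unit_measure)"
    by (rule nn_integral_suminf) measurable
  also have "\<dots> \<le> (\<Sum>k. ennreal C * ennreal ((1/2) ^ k))"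
  proof (intro suminf_le summableI)
    fix k
    have "(\<integral>\<^sup>+x. ennreal (f k x) \<partial>unit_measure) \<le> ennreal C * N (f k)"
      using C(2)[OF fm[of k]] nonneg by simp
    also have "\<dots> \<le> ennreal C * ennreal ((1/2) ^ k)" using le by (intro mult_left_mono) auto
    finally show "(\<integral>\<^sup>+x. ennreal (f k x) \<partial>unit_measure) \<le> ennreal C * ennreal ((1/2) ^ k)" .
  qed
  also have "\<dots> = ennreal C * ennreal 2"
    by (simp only: ennreal_suminf_cmult geo)
  also have "\<dots> < \<infinity>" by (auto intro: ennreal_mult_less_top[THEN iffD2])
  finally have "AE x in unit_measure. (\<Sum>k. ennreal (f k x)) \<noteq> \<infinity>"
    by (intro nn_integral_PInf_AE) auto
  then have summ: "AE x in unit_measure. summable (\<lambda>k. f k x)"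
    by eventually_elim (auto intro!: summable_suminf_not_top nonneg)
  \<comment> \<open>Where the series diverges, \<open>suminf\<close> is unspecified; this concerns a
    null set only.\<close>
  define g where "g x = (\<Sum>k. f k x)" for x
  have gm [measurable]: "g \<in> borel_measurable unit_measure"
    unfolding g_def by measurable
  \<comment> \<open>The tail is the a.e. limit of its partial sums, whose norms stay below the
    geometric sum from \<open>n\<close> on, which is \<open>2 * (1/2) ^ n\<close>.\<close>
  have tail: "N (\<lambda>x. g x - (\<Sum>k<n. f k x)) \<le> ennreal (2 * (1/2) ^ n)" for n
  proof (rule N_Fatou[where u = "\<lambda>m x. (\<Sum>k<m. f (k + n) x)"])
    show "AE x in unit_measure. (\<lambda>m. \<Sum>k<m. f (k + n) x) \<longlonglongrightarrow> g x - (\<Sum>k<n. f k x)"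
      using summ
    proof eventually_elim
      case (elim x)
      from sums_split_initial_segment[OF summable_sums[OF this], of n]
      show ?case by (simp add: g_def sums_def)
    qed
    fix m
    have "N (\<lambda>x. \<Sum>k<m. f (k + n) x) \<le> (\<Sum>k<m. N (f (k + n)))"
      by (rule N_sum) auto
    also have "\<dots> \<le> (\<Sum>k<m. ennreal ((1/2) ^ (k + n)))"
      by (intro sum_mono le)
    also have "\<dots> = ennreal (\<Sum>k<m. (1/2) ^ (k + n))" by (rule sum_ennreal) simp
    also have "(\<Sum>k<m. (1/2::real) ^ (k + n)) = (\<Sum>k<m. (1/2) ^ k) * (1/2) ^ n"
      by (simp add: power_add sum_distrib_right)
    also have "(\<Sum>k<m. (1/2::real) ^ k) * (1/2) ^ n \<le> 2 * (1/2) ^ n"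
      unfolding sum_gp_strict by (intro mult_right_mono) auto
    finally show "N (\<lambda>x. \<Sum>k<m. f (k + n) x) \<le> ennreal (2 * (1/2) ^ n)"
      by (auto simp: ennreal_leI)
  qed auto
  show ?thesis
  proof (rule that)
    show "g \<in> XS"
    proof (rule XS_closed[OF gm])
      fix e :: real assume "e > 0"
      then obtain n where "(1/2::real) ^ n < e / 2"
        using real_arch_pow_inv[of "e / 2" "1 / 2"] by auto
      then have "N (\<lambda>x. g x - (\<Sum>k<n. f k x)) \<le> ennreal e"
        using tail[of n] by (intro order_trans[OF tail] ennreal_leI) auto
      then show "\<exists>h\<in>XS. N (\<lambda>x. g x - h x) \<le> ennreal e"
        using XS_sum[of "{..<n}" f] f by (intro bexI[of _ "\<lambda>x. \<Sum>k<n. f k x"]) auto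
    qed
    fix k
    show "AE x in unit_measure. f k x \<le> g x"
      using summ
    proof eventually_elim
      case (elim x)
      from sum_le_suminf[OF this, of "{k}"] nonneg show ?case by (simp add: g_def)
    qed
  qed
qed

end

section \<open>Positive operators, operator norm and the local estimate\<close>

locale positive_linear_operator = banach_function_norm +
  fixes T :: "(real \<Rightarrow> real) \<Rightarrow> real \<Rightarrow> real"
  assumes linear: "linear_operator \<rho> T" and positive: "positive_operator \<rho> T"
begin

lemma T_in_XS: "f \<in> XS \<Longrightarrow> T f \<in> XS"
  using linear by (simp add: linear_operator_def)

lemma T_add: "f \<in> XS \<Longrightarrow> g \<in> XS \<Longrightarrow> AE x in unit_measure. T (\<lambda>t. f t + g t) x = T f x + T g x"
  using linear by (simp add: linear_operator_def)

lemma T_scale: "f \<in> XS \<Longrightarrow> AE x in unit_measure. T (\<lambda>t. c * f t) x = c * T f x"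
  using linear by (simp add: linear_operator_def)

lemma T_diff:
  assumes "f \<in> XS" "g \<in> XS"
  shows "AE x in unit_measure. T (\<lambda>t. f t - g t) x = T f x - T g x"
  using T_add[OF assms(1) XS_scale[OF assms(2), of "-1"]] T_scale[OF assms(2), of "-1"]
  by eventually_elim simp

lemma T_nonneg:
  "f \<in> XS \<Longrightarrow> AE x in unit_measure. 0 \<le> f x \<Longrightarrow> AE x in unit_measure. 0 \<le> T f x"
  using positive by (simp add: positive_operator_def)

lemma T_mono:
  assumes "f \<in> XS" "g \<in> XS" "AE x in unit_measure. f x \<le> g x"
  shows "AE x in unit_measure. T f x \<le> T g x"
  using T_nonneg[OF XS_diff[OF assms(2,1)]] T_diff[OF assms(2,1)] assms(3)
  by (auto elim: eventually_elim2)

text \<open>Monotonicity, applied to \<open>- g \<le> f\<close> and to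
  \<open>f \<le> g\<close>.\<close>

lemma T_abs_le:
  assumes f: "f \<in> XS" and g: "g \<in> XS" and le: "AE x in unit_measure. \<bar>f x\<bar> \<le> g x"
  shows "AE x in unit_measure. \<bar>T f x\<bar> \<le> T g x"
proof -
  have "AE x in unit_measure. T f x \<le> T g x"
    by (rule T_mono[OF f g]) (use le in eventually_elim, auto)
  moreover have "AE x in unit_measure. T (\<lambda>t. -1 * g t) x \<le> T f x"
    by (rule T_mono[OF XS_scale[OF g] f]) (use le in eventually_elim, auto)
  ultimately show ?thesis using T_scale[OF g, of "-1"] by eventually_elim auto
qed

end

text \<open>The supremum runs over the unit ball, so \<open>f\<close> is scaled to norm one and
  back. If \<open>N f = 0\<close> there is no such scaling, and the boundedness constant
  \<open>K\<close> gives \<open>N (T f) = 0\<close>.\<close>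

lemma (in banach_function_norm) operator_norm_bound:
  assumes T: "bounded_linear_operator \<rho> T" and f: "f \<in> XS"
  shows "N (T f) \<le> operator_norm \<rho> T * N f"
proof -
  obtain K where K: "N (T f) \<le> ennreal K * N f"
    using T f unfolding bounded_linear_operator_def by blast
  have lin: "linear_operator \<rho> T" using T by (simp add: bounded_linear_operator_def)
  obtain c where c: "N f = ennreal c" "c \<ge> 0" using XS_finite[OF f] by (cases "N f") auto
  show ?thesis
  proof (cases "c = 0")
    case True
    with K c show ?thesis by simp
  next
    case False
    with c have "c > 0" by simp
    define a where "a = 1 / c"
    have a: "a > 0" "c * a = 1" "a * c = 1" using \<open>c > 0\<close> by (auto simp: a_def)
    let ?g = "\<lambda>t. a * f t"
    have Tf: "T f \<in> XS" "T ?g \<in> XS" using lin f XS_scale[OF f] by (auto simp: linear_operator_def)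
    have "N ?g = ennreal a * N f"
      using XS_measurable[OF f] a by (subst N_scale) auto
    also have "\<dots> = 1" using a c by (simp flip: ennreal_mult)
    finally have g1: "N ?g = 1" .
    have "N (T ?g) = N (\<lambda>x. a * T f x)"
      using lin f XS_measurable[OF Tf(1)] XS_measurable[OF Tf(2)]
      by (intro N_cong) (auto simp: linear_operator_def)
    also have "\<dots> = ennreal a * N (T f)"
      using XS_measurable[OF Tf(1)] a by (subst N_scale) auto
    finally have "ennreal a * N (T f) \<le> operator_norm \<rho> T"
      using XS_scale[OF f, of a] g1 unfolding operator_norm_def
      by (intro SUP_upper2[of ?g]) auto
    then have "ennreal c * (ennreal a * N (T f)) \<le> ennreal c * operator_norm \<rho> T"
      by (rule mult_left_mono) simp
    then show ?thesis using a c by (simp add: mult.assoc[symmetric] mult.commute flip: ennreal_mult)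
  qed
qed

locale ac_positive_linear_operator = positive_linear_operator + ac_banach_function_norm
begin

lemma monomial_in_XS: "monomial i \<in> XS"
  by (rule continuous_in_XS) (auto simp: monomial_def[abs_def] intro!: continuous_intros)

text \<open>For fixed \<open>u\<close> this is \<open>T_abs_le\<close> with a quadratic majorant,
  but the null set depends on \<open>u\<close>, while \<open>u\<close> will later depend on
  \<open>x\<close>. Rational \<open>u\<close> share one null set, and both sides are continuous in
  \<open>u\<close>.\<close>

lemma T_local_estimate:
  assumes \<phi>: "continuous_on {0..1} \<phi>"
    and modulus: "\<forall>s\<in>{0..1}. \<forall>u\<in>{0..1}. \<bar>\<phi> s - \<phi> u\<bar> \<le> e + C * (s - u)\<^sup>2"
  shows "AE x in unit_measure. \<forall>u\<in>{0..1}. \<bar>T \<phi> x - \<phi> u * T (monomial 0) x\<bar>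
     \<le> e * T (monomial 0) x
       + C * (T (monomial 2) x - 2 * u * T (monomial 1) x + u\<^sup>2 * T (monomial 0) x)"
proof -
  let ?G = "\<lambda>x u. e * T (monomial 0) x
       + C * (T (monomial 2) x - 2 * u * T (monomial 1) x + u\<^sup>2 * T (monomial 0) x)
       - \<bar>T \<phi> x - \<phi> u * T (monomial 0) x\<bar>"
  have fixed: "AE x in unit_measure. 0 \<le> ?G x u" if u: "u \<in> {0..1}" for u
  proof -
    \<comment> \<open>The three terms of \<open>e + C * (t - u)\<^sup>2\<close>, expanded in powers
      of \<open>t\<close>.\<close>
    let ?q1 = "\<lambda>t. (e + C * u\<^sup>2) * monomial 0 t"
    let ?q2 = "\<lambda>t. (- 2 * C * u) * monomial 1 t"
    let ?q3 = "\<lambda>t. C * monomial 2 t"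
    let ?q = "\<lambda>t. (?q1 t + ?q2 t) + ?q3 t"
    let ?c = "\<lambda>t. \<phi> u * monomial 0 t"
    note in_XS = monomial_in_XS[THEN XS_scale]
    have "AE x in unit_measure. \<bar>T (\<lambda>t. \<phi> t - ?c t) x\<bar> \<le> T ?q x"
    proof (rule T_abs_le)
      show "(\<lambda>t. \<phi> t - ?c t) \<in> XS" by (intro XS_diff in_XS continuous_in_XS \<phi>)
      show "?q \<in> XS" by (intro XS_add in_XS)
      show "AE t in unit_measure. \<bar>\<phi> t - ?c t\<bar> \<le> ?q t"
      proof (rule AE_I2)
        fix t assume "t \<in> space unit_measure"
        then have "\<bar>\<phi> t - \<phi> u\<bar> \<le> e + C * (t - u)\<^sup>2" using modulus u by simp
        then show "\<bar>\<phi> t - ?c t\<bar> \<le> ?q t"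
          unfolding monomial_def by (simp add: power2_diff algebra_simps)
      qed
    qed
    moreover have "AE x in unit_measure. T (\<lambda>t. \<phi> t - ?c t) x = T \<phi> x - T ?c x"
      by (intro T_diff in_XS continuous_in_XS \<phi>)
    moreover have "AE x in unit_measure. T ?q x = T (\<lambda>t. ?q1 t + ?q2 t) x + T ?q3 x"
      by (rule T_add) (intro XS_add in_XS)+
    moreover have "AE x in unit_measure. T (\<lambda>t. ?q1 t + ?q2 t) x = T ?q1 x + T ?q2 x"
      by (rule T_add) (intro in_XS)+
    moreover note T_scale[OF monomial_in_XS, of "e + C * u\<^sup>2" 0] T_scale[OF monomial_in_XS, of "- 2 * C * u" 1]
      T_scale[OF monomial_in_XS, of C 2] T_scale[OF monomial_in_XS, of "\<phi> u" 0]
    ultimately show ?thesis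
    proof eventually_elim
      case (elim x)
      have "T ?q x = (e + C * u\<^sup>2) * T (monomial 0) x + (- 2 * C * u) * T (monomial 1) x
          + C * T (monomial 2) x"
        by (simp only: elim(3-7))
      moreover have "\<bar>T \<phi> x - \<phi> u * T (monomial 0) x\<bar> \<le> T ?q x"
        using elim(1) by (simp only: elim(2,8))
      ultimately have "\<bar>T \<phi> x - \<phi> u * T (monomial 0) x\<bar>
          \<le> (e + C * u\<^sup>2) * T (monomial 0) x + (- 2 * C * u) * T (monomial 1) x + C * T (monomial 2) x"
        by (simp only:)
      also have "\<dots> = e * T (monomial 0) x
          + C * (T (monomial 2) x - 2 * u * T (monomial 1) x + u\<^sup>2 * T (monomial 0) x)"
        by (simp add: algebra_simps)
      finally show ?case by simp
    qed
  qed
  have "AE x in unit_measure. \<forall>u\<in>\<rat> \<inter> {0..1}. 0 \<le> ?G x u"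
    using fixed by (subst AE_ball_countable) (auto intro: countable_Int1 countable_rat)
  then show ?thesis
  proof eventually_elim
    case (elim x)
    have "0 \<le> ?G x u" if "u \<in> {0..1}" for u
    proof (rule nonneg_if_nonneg_on_Rats[OF _ _ that])
      show "continuous_on {0..1} (?G x)" using \<phi> by (intro continuous_intros)
    qed (use elim in auto)
    then show ?case by auto
  qed
qed

end

section \<open>Convergence on continuous functions, and the two implications\<close>

locale korovkin = ac_banach_function_norm +
  fixes L :: "nat \<Rightarrow> (real \<Rightarrow> real) \<Rightarrow> real \<Rightarrow> real"
    and A :: "(real \<Rightarrow> real) \<Rightarrow> real \<Rightarrow> real"
  assumes L_bounded: "\<And>n. bounded_linear_operator \<rho> (L n)"
    and L_positive: "\<And>n. positive_operator \<rho> (L n)"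
    and A_bounded: "bounded_linear_operator \<rho> A" and A_positive: "positive_operator \<rho> A"
    and degenerate: "\<forall>t\<in>{0..1}. cont_version (A (monomial 0)) t * cont_version (A (monomial 2)) t
           = (cont_version (A (monomial 1)) t)\<^sup>2"
    and A0_positive: "\<forall>t\<in>{0..1}. cont_version (A (monomial 0)) t > 0"
    and test_functions: "\<forall>i\<in>{0, 1, 2}. converges_in_C01 (\<lambda>n. L n (monomial i)) (A (monomial i))"
begin

sublocale L: ac_positive_linear_operator \<rho> "L n" for n
  using L_bounded L_positive by unfold_locales (auto simp: bounded_linear_operator_def)

sublocale A: ac_positive_linear_operator \<rho> A
  using A_bounded A_positive by unfold_locales (auto simp: bounded_linear_operator_def)

lemma converges_continuous:
  assumes \<phi>: "continuous_on {0..1} \<phi>"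
  shows "(\<lambda>n. N (\<lambda>x. L n \<phi> x - A \<phi> x)) \<longlonglongrightarrow> 0"
proof (rule ennreal_tendsto_0I)
  fix e :: real assume e: "e > 0"
  have in_C01: "in_C01 (A (monomial i))" if "i \<in> {0, 1, 2}" for i
    using test_functions that unfolding converges_in_C01_def by blast
  let ?a = "\<lambda>i. cont_version (A (monomial i))"
  have a: "AE x in unit_measure. A (monomial 0) x = ?a 0 x"
    "AE x in unit_measure. A (monomial 1) x = ?a 1 x"
    "AE x in unit_measure. A (monomial 2) x = ?a 2 x"
    by (rule in_C01_cont_version(2)[OF in_C01], simp)+
  obtain d0 where d0: "d0 \<longlonglongrightarrow> 0"
    "\<And>n. AE x in unit_measure. \<bar>L n (monomial 0) x - A (monomial 0) x\<bar> \<le> d0 n"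
    by (rule converges_in_C01_AE[of "\<lambda>n. L n (monomial 0)" "A (monomial 0)"])
       (use test_functions in auto)
  obtain d1 where d1: "d1 \<longlonglongrightarrow> 0"
    "\<And>n. AE x in unit_measure. \<bar>L n (monomial 1) x - A (monomial 1) x\<bar> \<le> d1 n"
    by (rule converges_in_C01_AE[of "\<lambda>n. L n (monomial 1)" "A (monomial 1)"])
       (use test_functions in auto)
  obtain d2 where d2: "d2 \<longlonglongrightarrow> 0"
    "\<And>n. AE x in unit_measure. \<bar>L n (monomial 2) x - A (monomial 2) x\<bar> \<le> d2 n"
    by (rule converges_in_C01_AE[of "\<lambda>n. L n (monomial 2)" "A (monomial 2)"])
       (use test_functions in auto)
  \<comment> \<open>One error for the three test functions, since \<open>korovkin_pointwise\<close>
    takes a single \<open>d\<close>.\<close>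
  define d where "d n = \<bar>d0 n\<bar> + \<bar>d1 n\<bar> + \<bar>d2 n\<bar>" for n
  have "(\<lambda>n. \<bar>d0 n\<bar> + \<bar>d1 n\<bar> + \<bar>d2 n\<bar>) \<longlonglongrightarrow> 0 + 0 + 0"
    by (intro tendsto_add tendsto_rabs_zero d0 d1 d2)
  then have d: "d \<longlonglongrightarrow> 0" by (simp add: d_def[abs_def])
  have d_nonneg: "d n \<ge> 0" for n by (simp add: d_def)
  define M where "M = C01_norm (?a 0)"
  have M: "\<bar>?a 0 x\<bar> \<le> M" if "x \<in> {0..1}" for x
    unfolding M_def by (rule C01_norm_upper[OF in_C01_cont_version(1)[OF in_C01] that]) simp
  have M0: "M \<ge> 0" using M[of 0] by auto
  define F where "F = C01_norm \<phi>"
  have F: "\<bar>\<phi> x\<bar> \<le> F" if "x \<in> {0..1}" for x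
    unfolding F_def by (rule C01_norm_upper[OF \<phi> that])
  have F0: "F \<ge> 0" using F[of 0] by auto
  \<comment> \<open>By \<open>N_le_bound\<close> an a.e. bound \<open>e'\<close> costs a factor
    \<open>norm1\<close> in the norm; the added 1 covers \<open>norm1 = 0\<close>.\<close>
  define e' where "e' = e / (norm1 + 1)"
  have e': "e' > 0" "e' * norm1 \<le> e" using e norm1(2) by (auto simp: e'_def field_simps)
  \<comment> \<open>The modulus error has weight \<open>2 * M + d n\<close>, so that for
    \<open>d n < 1\<close> it uses half of \<open>e'\<close>. The other half is for
    \<open>(F + 4 * C) * d n\<close>, where \<open>C\<close> depends on \<open>\<epsilon>\<close>
    but not on \<open>n\<close>.\<close>
  define \<epsilon> where "\<epsilon> = e' / (2 * (2 * M + 1))"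
  have \<epsilon>: "\<epsilon> > 0" "\<epsilon> * (2 * M + 1) = e' / 2" using e' M0 by (auto simp: \<epsilon>_def field_simps)
  obtain C where C: "C \<ge> 0"
    "\<forall>s\<in>{0..1}. \<forall>u\<in>{0..1}. \<bar>\<phi> s - \<phi> u\<bar> \<le> \<epsilon> + C * (s - u)\<^sup>2"
    using continuous_quadratic_modulus[OF \<phi> \<epsilon>(1)] by blast
  have "(\<lambda>n. (F + 4 * C) * d n) \<longlonglongrightarrow> (F + 4 * C) * 0" by (intro tendsto_mult tendsto_const d)
  then have "eventually (\<lambda>n. (F + 4 * C) * d n < e' / 2) sequentially"
    using order_tendstoD(2)[of "\<lambda>n. (F + 4 * C) * d n" 0 sequentially "e' / 2"] e' by simp
  moreover have "eventually (\<lambda>n. d n < 1) sequentially"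
    using order_tendstoD(2)[OF d, of 1] by simp
  ultimately show "eventually (\<lambda>n. N (\<lambda>x. L n \<phi> x - A \<phi> x) \<le> ennreal e) sequentially"
  proof eventually_elim
    case (elim n)
    have bound: "F * d n + \<epsilon> * (2 * M + d n) + 4 * C * d n \<le> e'"
    proof -
      have "\<epsilon> * (2 * M + d n) \<le> \<epsilon> * (2 * M + 1)" using elim \<epsilon>(1) by (intro mult_left_mono) auto
      with elim \<epsilon>(2) show ?thesis by (simp add: algebra_simps)
    qed
    \<comment> \<open>This and \<open>A1_le\<close> place the quotient \<open>?u\<close> below in
      the unit interval.\<close>
    have A1_nonneg: "AE x in unit_measure. 0 \<le> A (monomial 1) x"
      by (rule A.T_nonneg[OF A.monomial_in_XS]) (auto simp: monomial_def intro!: AE_I2)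
    have A1_le: "AE x in unit_measure. A (monomial 1) x \<le> A (monomial 0) x"
      by (rule A.T_mono[OF A.monomial_in_XS A.monomial_in_XS]) (auto simp: monomial_def intro!: AE_I2)
    have "AE x in unit_measure. \<bar>L n \<phi> x - A \<phi> x\<bar> \<le> e'"
      using L.T_local_estimate[OF \<phi> C(2), of n] A.T_local_estimate[OF \<phi> C(2)] A1_nonneg A1_le a
        d0(2)[of n] d1(2)[of n] d2(2)[of n] AE_space
    proof eventually_elim
      case (elim x)
      \<comment> \<open>The point may depend on \<open>x\<close>, because the local estimates hold
        for all \<open>u\<close> off one null set.\<close>
      let ?u = "A (monomial 1) x / A (monomial 0) x"
      have x: "x \<in> {0..1}" using elim by simp
      have pos: "A (monomial 0) x > 0" using A0_positive x elim(5) by auto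
      have u: "?u \<in> {0..1}" using elim(3,4) pos by auto
      have "\<bar>L n \<phi> x - A \<phi> x\<bar> \<le> F * d n + \<epsilon> * (2 * M + d n) + 4 * C * d n"
      proof (rule korovkin_pointwise[OF pos _ elim(3,4) _ _ _ refl])
        show "A (monomial 0) x * A (monomial 2) x = (A (monomial 1) x)\<^sup>2"
          using degenerate x elim(5-7) by auto
        show "\<bar>L n (monomial 0) x - A (monomial 0) x\<bar> \<le> d n"
          "\<bar>L n (monomial 1) x - A (monomial 1) x\<bar> \<le> d n"
          "\<bar>L n (monomial 2) x - A (monomial 2) x\<bar> \<le> d n"
          using elim(8-10) by (auto simp: d_def)
        show "\<bar>\<phi> ?u\<bar> \<le> F" by (rule F[OF u])
        show "A (monomial 0) x \<le> M" using M[OF x] elim(5) by auto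
        show "0 \<le> \<epsilon>" "0 \<le> C" using \<epsilon> C by auto
      qed (use elim(1,2) u in blast)+
      with bound show ?case by linarith
    qed
    then have "N (\<lambda>x. L n \<phi> x - A \<phi> x) \<le> ennreal (e' * norm1)"
      using L.T_in_XS[OF continuous_in_XS[OF \<phi>]] A.T_in_XS[OF continuous_in_XS[OF \<phi>]] XS_measurable e'
      by (intro N_le_bound) auto
    also have "\<dots> \<le> ennreal e" using e' by (intro ennreal_leI)
    finally show ?case .
  qed
qed

text \<open>A three-epsilon argument: for a continuous \<open>\<phi>\<close> near \<open>f\<close>,
  the uniform bound controls \<open>L n\<close> on \<open>f - \<phi>\<close> for all
  \<open>n\<close> at once.\<close>

lemma converges_if_uniformly_bounded:
  assumes bounded: "(SUP n. operator_norm \<rho> (L n)) < \<infinity>" and f: "f \<in> XS"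
  shows "(\<lambda>n. N (\<lambda>x. L n f x - A f x)) \<longlonglongrightarrow> 0"
proof (rule ennreal_tendsto_0I)
  fix e :: real assume e: "e > 0"
  obtain K where K: "K \<ge> 0" "(SUP n. operator_norm \<rho> (L n)) = ennreal K"
    using bounded by (cases "SUP n. operator_norm \<rho> (L n)") auto
  obtain K' where K': "\<forall>f\<in>XS. N (A f) \<le> ennreal K' * N f"
    using A_bounded unfolding bounded_linear_operator_def by blast
  \<comment> \<open>One constant for \<open>A\<close> and all \<open>L n\<close>. The modulus is
    taken because \<open>K'\<close> may be negative, and the 1 makes \<open>B\<close> a valid
    divisor.\<close>
  define B where "B = K + \<bar>K'\<bar> + 1"
  have B: "B > 0" "K \<le> B" "K' \<le> B" using K(1) by (auto simp: B_def)
  have L_le: "N (L n g) \<le> ennreal B * N g" if "g \<in> XS" for n g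
  proof -
    have "operator_norm \<rho> (L n) \<le> ennreal K" unfolding K(2)[symmetric] by (rule SUP_upper) simp
    also have "\<dots> \<le> ennreal B" using B by (intro ennreal_leI)
    finally show ?thesis
      using operator_norm_bound[OF L_bounded[of n] that] by (meson mult_right_mono order_trans zero_le)
  qed
  have A_le: "N (A g) \<le> ennreal B * N g" if "g \<in> XS" for g
    using K' that B by (meson ennreal_leI mult_right_mono order_trans zero_le)
  obtain \<phi> where \<phi>: "continuous_on {0..1} \<phi>" "N (\<lambda>x. f x - \<phi> x) \<le> ennreal (e / (3 * B))"
    using XS_approx_continuous[OF f, of "e / (3 * B)"] e B by auto
  have \<phi>X: "\<phi> \<in> XS" by (rule continuous_in_XS[OF \<phi>(1)])
  have small: "ennreal B * N (\<lambda>x. f x - \<phi> x) \<le> ennreal (e / 3)"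
  proof -
    have "ennreal B * N (\<lambda>x. f x - \<phi> x) \<le> ennreal B * ennreal (e / (3 * B))"
      using \<phi>(2) by (rule mult_left_mono) simp
    also have "\<dots> = ennreal (e / 3)" using B e by (simp flip: ennreal_mult)
    finally show ?thesis .
  qed
  have "eventually (\<lambda>n. N (\<lambda>x. L n \<phi> x - A \<phi> x) \<le> ennreal (e / 3)) sequentially"
    using ennreal_tendsto_0D[OF converges_continuous[OF \<phi>(1)], of "e / 3"] e by simp
  then show "eventually (\<lambda>n. N (\<lambda>x. L n f x - A f x) \<le> ennreal e) sequentially"
  proof eventually_elim
    case (elim n)
    have [measurable]: "L n f \<in> borel_measurable unit_measure" "L n \<phi> \<in> borel_measurable unit_measure"
      "A f \<in> borel_measurable unit_measure" "A \<phi> \<in> borel_measurable unit_measure"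
      "L n (\<lambda>t. f t - \<phi> t) \<in> borel_measurable unit_measure"
      "A (\<lambda>t. f t - \<phi> t) \<in> borel_measurable unit_measure"
      using L.T_in_XS A.T_in_XS f \<phi>X XS_diff[OF f \<phi>X] XS_measurable by auto
    have "N (\<lambda>x. L n f x - L n \<phi> x) = N (L n (\<lambda>t. f t - \<phi> t))"
      by (rule N_cong) (use L.T_diff[OF f \<phi>X, of n] in \<open>auto elim: eventually_mono\<close>)
    also have "\<dots> \<le> ennreal (e / 3)"
      using L_le[OF XS_diff[OF f \<phi>X]] small by (rule order_trans)
    finally have 1: "N (\<lambda>x. L n f x - L n \<phi> x) \<le> ennreal (e / 3)" .
    have "N (\<lambda>x. A \<phi> x - A f x) = N (\<lambda>x. A f x - A \<phi> x)" by (rule N_minus_commute)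
    also have "\<dots> = N (A (\<lambda>t. f t - \<phi> t))"
      by (rule N_cong) (use A.T_diff[OF f \<phi>X] in \<open>auto elim: eventually_mono\<close>)
    also have "\<dots> \<le> ennreal (e / 3)"
      using A_le[OF XS_diff[OF f \<phi>X]] small by (rule order_trans)
    finally have 2: "N (\<lambda>x. A \<phi> x - A f x) \<le> ennreal (e / 3)" .
    have "N (\<lambda>x. L n f x - A f x) \<le> N (\<lambda>x. L n f x - L n \<phi> x) + N (\<lambda>x. L n \<phi> x - A f x)"
      by (rule N_triangle) auto
    also have "\<dots> \<le> N (\<lambda>x. L n f x - L n \<phi> x) + (N (\<lambda>x. L n \<phi> x - A \<phi> x) + N (\<lambda>x. A \<phi> x - A f x))"
      by (intro add_mono order_refl N_triangle) auto
    also have "\<dots> \<le> ennreal (e / 3) + (ennreal (e / 3) + ennreal (e / 3))"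
      using 1 2 elim by (intro add_mono)
    also have "\<dots> = ennreal e" using e by (simp flip: ennreal_plus)
    finally show ?case .
  qed
qed

text \<open>
  Positivity replaces Baire's theorem: a weighted sum \<open>f\<close> of moduli \<open>\<bar>h k\<bar>\<close> of unit vectors
  dominates each summand, hence \<open>L n f\<close> dominates each \<open>\<bar>L n (h k)\<bar>\<close> up to the weight.
\<close>

lemma uniformly_bounded_if_converges:
  assumes conv: "\<And>f. f \<in> XS \<Longrightarrow> (\<lambda>n. N (\<lambda>x. L n f x - A f x)) \<longlonglongrightarrow> 0"
  shows "(SUP n. operator_norm \<rho> (L n)) < \<infinity>"
proof (rule ccontr)
  assume "\<not> (SUP n. operator_norm \<rho> (L n)) < \<infinity>"
  then have top: "(SUP n. operator_norm \<rho> (L n)) = top" by (metis infinity_ennreal_def top.not_eq_extremum)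
  \<comment> \<open>The growth \<open>4 ^ k\<close> beats the weights \<open>(1/2) ^ k\<close> of
    the series below and leaves \<open>2 ^ k\<close>.\<close>
  have "\<exists>n h. h \<in> XS \<and> N h \<le> 1 \<and> ennreal (4 ^ k) < N (L n h)" for k :: nat
  proof -
    have "ennreal (4 ^ k) < (SUP n. operator_norm \<rho> (L n))" unfolding top by simp
    then obtain n where "ennreal (4 ^ k) < operator_norm \<rho> (L n)" by (auto simp: less_SUP_iff)
    then show ?thesis unfolding operator_norm_def less_SUP_iff by blast
  qed
  then obtain n h where h: "\<And>k. h k \<in> XS" "\<And>k. N (h k) \<le> 1"
    "\<And>k::nat. ennreal (4 ^ k) < N (L (n k) (h k))" by metis
  let ?f = "\<lambda>k t. (1/2::real) ^ k * \<bar>h k t\<bar>"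
  have fX: "?f k \<in> XS" for k by (intro XS_scale XS_abs h)
  obtain g where g: "g \<in> XS" "\<And>k. AE x in unit_measure. ?f k x \<le> g x"
  proof (rule XS_monotone_series[of ?f])
    fix k
    have "N (?f k) = ennreal ((1/2) ^ k) * N (\<lambda>x. \<bar>h k x\<bar>)"
      using XS_measurable[OF XS_abs[OF h(1)[of k]]] by (subst N_scale) auto
    also have "N (\<lambda>x. \<bar>h k x\<bar>) = N (h k)" by (simp add: bfs_norm_def)
    also have "ennreal ((1/2) ^ k) * N (h k) \<le> ennreal ((1/2) ^ k) * 1"
      using h(2) by (intro mult_left_mono) auto
    finally show "N (?f k) \<le> ennreal ((1/2) ^ k)" by simp
  qed (use fX in auto)
  have large: "ennreal (2 ^ k) \<le> N (L (n k) g)" for k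
  proof -
    have LX: "L (n k) (h k) \<in> XS" "L (n k) g \<in> XS" using L.T_in_XS h g by auto
    have "AE x in unit_measure. \<bar>L (n k) (h k) x\<bar> \<le> L (n k) (\<lambda>t. \<bar>h k t\<bar>) x"
      by (intro L.T_abs_le h XS_abs) auto
    moreover have "AE x in unit_measure. L (n k) (?f k) x = (1/2) ^ k * L (n k) (\<lambda>t. \<bar>h k t\<bar>) x"
      by (intro L.T_scale XS_abs h)
    moreover have "AE x in unit_measure. L (n k) (?f k) x \<le> L (n k) g x"
      by (rule L.T_mono[OF fX g])
    ultimately have "AE x in unit_measure. \<bar>(1/2) ^ k * L (n k) (h k) x\<bar> \<le> \<bar>L (n k) g x\<bar>"
    proof eventually_elim
      case (elim x)
      have "\<bar>(1/2) ^ k * L (n k) (h k) x\<bar> = (1/2) ^ k * \<bar>L (n k) (h k) x\<bar>"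
        by (simp add: abs_mult)
      also have "\<dots> \<le> (1/2) ^ k * L (n k) (\<lambda>t. \<bar>h k t\<bar>) x"
        using elim(1) by (rule mult_left_mono) simp
      also have "\<dots> \<le> \<bar>L (n k) g x\<bar>" using elim(2,3) by linarith
      finally show ?case .
    qed
    then have "N (\<lambda>x. (1/2) ^ k * L (n k) (h k) x) \<le> N (L (n k) g)"
      using XS_measurable LX by (intro N_mono) auto
    moreover have "N (\<lambda>x. (1/2) ^ k * L (n k) (h k) x) = ennreal ((1/2) ^ k) * N (L (n k) (h k))"
      using XS_measurable[OF LX(1)] by (subst N_scale) auto
    moreover have "ennreal ((1/2) ^ k) * ennreal (4 ^ k) \<le> ennreal ((1/2) ^ k) * N (L (n k) (h k))"
      using h(3)[of k] by (intro mult_left_mono) auto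
    moreover have "ennreal ((1/2) ^ k) * ennreal (4 ^ k) = ennreal (2 ^ k)"
      by (simp flip: ennreal_mult power_mult_distrib)
    ultimately show ?thesis by simp
  qed
  have LAX: "L m g \<in> XS" "A g \<in> XS" for m using L.T_in_XS A.T_in_XS g by auto
  obtain m0 where m0: "\<And>m. m \<ge> m0 \<Longrightarrow> N (\<lambda>x. L m g x - A g x) \<le> ennreal 1"
    using ennreal_tendsto_0D[OF conv[OF g(1)], of 1] unfolding eventually_sequentially by auto
  \<comment> \<open>A finite bound for all \<open>L m g\<close>, contradicting \<open>large\<close>:
    indices below \<open>m0\<close> are covered by the sum, and later ones lie within distance 1 of
    \<open>A g\<close>.\<close>
  let ?B = "1 + N (A g) + (\<Sum>m<m0. N (L m g))"
  have "N (L m g) \<le> ?B" for m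
  proof (cases "m < m0")
    case True
    then have "N (L m g) \<le> (\<Sum>m<m0. N (L m g))" by (intro member_le_sum) auto
    then show ?thesis by (rule order_trans) simp
  next
    case False
    have "N (L m g) \<le> N (\<lambda>x. L m g x - A g x) + N (A g)"
      using N_add[of "\<lambda>x. L m g x - A g x" "A g"] XS_measurable[OF LAX(1)] XS_measurable[OF LAX(2)]
      by simp
    also have "\<dots> \<le> 1 + N (A g)" using m0[of m] False by (intro add_mono) auto
    finally show ?thesis by (rule order_trans) simp
  qed
  with large have le: "ennreal (2 ^ k) \<le> ?B" for k by (blast intro: order_trans)
  have "?B < \<infinity>" using XS_finite[OF LAX(1)] XS_finite[OF LAX(2)] by auto
  then obtain b where b: "?B = ennreal b" "b \<ge> 0" by (cases ?B) auto
  obtain k where "b < 2 ^ k" using real_arch_pow[of 2 b] by auto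
  with le[of k] b show False by (simp add: ennreal_le_iff)
qed

end

theorem theorem11:
  fixes \<rho> :: "(real \<Rightarrow> real) \<Rightarrow> ennreal"
    and L :: "nat \<Rightarrow> (real \<Rightarrow> real) \<Rightarrow> real \<Rightarrow> real"
    and A :: "(real \<Rightarrow> real) \<Rightarrow> real \<Rightarrow> real"
  assumes "function_norm \<rho>"
    and "(\<lambda>x. 1) \<in> bfs_ac \<rho>"
    and "\<And>n. bounded_linear_operator \<rho> (L n)" and "\<And>n. positive_operator \<rho> (L n)"
    and "bounded_linear_operator \<rho> A" and "positive_operator \<rho> A"
    and "\<forall>t\<in>{0..1}. cont_version (A (monomial 0)) t * cont_version (A (monomial 2)) t
           = (cont_version (A (monomial 1)) t)\<^sup>2"
    and "\<forall>t\<in>{0..1}. cont_version (A (monomial 0)) t > 0"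
    and "\<forall>i\<in>{0, 1, 2}. converges_in_C01 (\<lambda>n. L n (monomial i)) (A (monomial i))"
  shows "(\<forall>f\<in>bfs_shift \<rho>. converges_in_bfs \<rho> (\<lambda>n. L n f) (A f)) \<longleftrightarrow>
         (SUP n. operator_norm \<rho> (L n)) < \<infinity>"
proof -
  interpret korovkin \<rho> L A
    by unfold_locales (fact assms)+
  show ?thesis
    using converges_if_uniformly_bounded uniformly_bounded_if_converges
    unfolding converges_in_bfs_def by blast
qed

end
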